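(* Let $\Omega\subset\mathbb{R}^n$, $n\ge 2$, be a regular domain, let $F\in C^2(\mathbb{R})$ be a non-positive function, let $f=F'$, let $\kappa$ be a constant, and let $u\in C^3(\Omega)$ be a bounded solution of $$\begin{cases}\Delta u+f(u)=0 & \text{in }\Omega,\\ u>0 & \text{in }\Omega,\\ u=0 & \text{on }\partial\Omega,\\ \partial_\nu u=-\kappa & \text{on }\partial\Omega.\end{cases}$$ Define $P(x)=|\nabla u(x)|^2+2F(u(x))$. Then $$P(x)\le \max\{0,\kappa^2+2F(0)\}\quad\text{for all } x\in\Omega .$$ Moreover, if there exists a point $x_0\in\Omega$ such that $$P(x_0)=\max\{0,\kappa^2+2F(0)\},$$ then $P$ is constant, $u$ is $1$-dimensional and $\Omega$ is a half-space.
   Context: A regular domain is a connected open set $\Omega\subset\mathbb{R}^n$, bounded or not, with nonempty smooth boundary. $\nu$ denotes the outward unit normal to $\partial\Omega$. The boundary conditions are understood in the classical sense ($u$ is of class $C^1$ up to $\partial\Omega$). The function $u$ is called $1$-dimensional if there exist $\vec a\in\mathbb{R}^n$, $x_0\in\mathbb{R}^n$ and a real function $g$ of one variable such that $u(x)=g(\vec a\cdot(x-x_0))$ for all $x\in\Omega$. *)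

theory Defs
  imports "HOL-Analysis.Analysis"
begin

text \<open>Class \<open>C\<^sup>k\<close> on an open set \<open>S\<close>; on other sets the predicate is not intended to be used,
  since the derivatives below are full derivatives \<open>at x\<close>.\<close>

primrec Ck_on :: "nat \<Rightarrow> ('a::real_normed_vector \<Rightarrow> real) \<Rightarrow> 'a set \<Rightarrow> bool" where
  "Ck_on 0 f S \<longleftrightarrow> continuous_on S f"
| "Ck_on (Suc k) f S \<longleftrightarrow>
     (\<forall>x\<in>S. f differentiable (at x)) \<and> (\<forall>v. Ck_on k (\<lambda>x. frechet_derivative f (at x) v) S)"

definition smooth_on :: "('a::real_normed_vector \<Rightarrow> real) \<Rightarrow> 'a set \<Rightarrow> bool" where
  "smooth_on f S \<longleftrightarrow> (\<forall>k. Ck_on k f S)"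

definition grad :: "('a::euclidean_space \<Rightarrow> real) \<Rightarrow> 'a \<Rightarrow> 'a" where
  "grad u x = (\<Sum>b\<in>Basis. frechet_derivative u (at x) b *\<^sub>R b)"

definition laplacian :: "('a::euclidean_space \<Rightarrow> real) \<Rightarrow> 'a \<Rightarrow> real" where
  "laplacian u x =
     (\<Sum>b\<in>Basis. frechet_derivative (\<lambda>y. frechet_derivative u (at y) b) (at x) b)"

text \<open>\<open>\<phi>\<close> is a smooth defining function of \<open>\<Omega>\<close> near the boundary point \<open>p\<close>. In particular
  \<open>\<Omega>\<close> lies locally on one side of its boundary, which near \<open>p\<close> is \<open>{\<phi> = 0}\<close>.\<close>

definition defining_function ::
  "'a::euclidean_space set \<Rightarrow> 'a \<Rightarrow> 'a set \<Rightarrow> ('a \<Rightarrow> real) \<Rightarrow> bool" where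
  "defining_function \<Omega> p U \<phi> \<longleftrightarrow>
     open U \<and> p \<in> U \<and> smooth_on \<phi> U \<and> (\<forall>x\<in>U. grad \<phi> x \<noteq> 0) \<and> \<Omega> \<inter> U = {x \<in> U. \<phi> x < 0}"

definition regular_domain :: "'a::euclidean_space set \<Rightarrow> bool" where
  "regular_domain \<Omega> \<longleftrightarrow>
     open \<Omega> \<and> connected \<Omega> \<and> frontier \<Omega> \<noteq> {} \<and>
     (\<forall>p\<in>frontier \<Omega>. \<exists>U \<phi>. defining_function \<Omega> p U \<phi>)"

text \<open>The vector below does not depend on the choice of the defining function.\<close>

definition outward_unit_normal :: "'a::euclidean_space set \<Rightarrow> 'a \<Rightarrow> 'a \<Rightarrow> bool" where
  "outward_unit_normal \<Omega> p \<nu> \<longleftrightarrow>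
     (\<exists>U \<phi>. defining_function \<Omega> p U \<phi> \<and> \<nu> = grad \<phi> p /\<^sub>R norm (grad \<phi> p))"

definition C1_up_to_boundary :: "'a::euclidean_space set \<Rightarrow> ('a \<Rightarrow> real) \<Rightarrow> bool" where
  "C1_up_to_boundary \<Omega> u \<longleftrightarrow>
     Ck_on 1 u \<Omega> \<and> continuous_on (closure \<Omega>) u \<and>
     (\<exists>G. continuous_on (closure \<Omega>) G \<and> (\<forall>x\<in>\<Omega>. G x = grad u x))"

text \<open>\<open>\<partial>\<^sub>\<nu> u = d\<close> at \<open>p\<close>, where the gradient of \<open>u\<close> at the boundary point \<open>p\<close> is its limit from
  inside \<open>\<Omega>\<close>; the values of \<open>u\<close> outside \<open>\<Omega>\<close> play no role.\<close>

definition has_normal_derivative ::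
  "'a::euclidean_space set \<Rightarrow> ('a \<Rightarrow> real) \<Rightarrow> 'a \<Rightarrow> real \<Rightarrow> bool" where
  "has_normal_derivative \<Omega> u p d \<longleftrightarrow>
     (\<exists>\<nu>. outward_unit_normal \<Omega> p \<nu> \<and> ((\<lambda>x. grad u x \<bullet> \<nu>) \<longlongrightarrow> d) (at p within \<Omega>))"

definition P_function ::
  "(real \<Rightarrow> real) \<Rightarrow> ('a::euclidean_space \<Rightarrow> real) \<Rightarrow> 'a \<Rightarrow> real" where
  "P_function F u x = (norm (grad u x))\<^sup>2 + 2 * F (u x)"

definition one_dimensional_on :: "'a::euclidean_space set \<Rightarrow> ('a \<Rightarrow> real) \<Rightarrow> bool" where
  "one_dimensional_on \<Omega> u \<longleftrightarrow> (\<exists>a x0. \<exists>g :: real \<Rightarrow> real. \<forall>x\<in>\<Omega>. u x = g (a \<bullet> (x - x0)))"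

definition half_space :: "'a::euclidean_space set \<Rightarrow> bool" where
  "half_space \<Omega> \<longleftrightarrow> (\<exists>a c. a \<noteq> 0 \<and> \<Omega> = {x. a \<bullet> x < c})"

end

theory Submission
  imports Defs
begin

text \<open>Bochner's identity gives
  \<open>\<bar>\<nabla>u\<bar>\<^sup>2 \<Delta>P + 2 f(u) \<nabla>u \<bullet> \<nabla>P \<ge> \<bar>\<nabla>P\<bar>\<^sup>2 / 2\<close>, and \<open>P \<le> \<bar>\<nabla>u\<bar>\<^sup>2\<close> since \<open>F \<le> 0\<close>, so this inequality is
  nondegenerate wherever \<open>P\<close> is positive. There \<open>exp (\<Lambda> u)\<close> is a strict subsolution for large \<open>\<Lambda>\<close>. Hence
  \<open>\<eta> P + \<epsilon> exp (\<Lambda> u)\<close>, with \<open>\<eta>\<close> a cutoff on a large ball, has no interior maximum at a point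
  with \<open>P > d\<^sup>2 > 0\<close>; letting the radius tend to infinity, then \<open>\<epsilon>\<close> and \<open>d\<close> to 0, bounds \<open>P\<close> by its boundary values without
  any compactness for families of solutions. On the boundary \<open>\<bar>\<nabla>u\<bar> = \<bar>\<kappa>\<bar>\<close>.

  If the bound \<open>m\<close> is attained, the strong maximum principle makes \<open>P\<close> constant; it applies because
  \<open>\<nabla>u = 0\<close> at such a point would give \<open>F(u) = 0\<close> there, and then \<open>\<bar>\<nabla>u\<bar>\<^sup>2 \<le> - 2 F(u)\<close> with Gronwall's
  inequality would make \<open>u\<close> constant. Since \<open>u\<close> is bounded and vanishes on the boundary, its gradient
  is not bounded away from zero, so \<open>m = 0\<close> and \<open>\<bar>\<nabla>u\<bar>\<^sup>2 = - 2 F(u)\<close>. Equality in Bochner's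
  inequality then forces \<open>\<nabla>u\<close> to have constant direction \<open>e\<close>, and a suitable increasing function of \<open>u\<close>
  equals \<open>e \<bullet> x\<close> up to a constant.\<close>

section \<open>Directional derivatives\<close>

text \<open>A one-variable derivative at 0 along the line through \<open>x\<close>, so that the
  calculus rules and the mean value theorem for real functions apply directly.\<close>

definition has_pd :: "('a::real_normed_vector \<Rightarrow> real) \<Rightarrow> 'a \<Rightarrow> real \<Rightarrow> 'a \<Rightarrow> bool" where
  "has_pd f b d x \<longleftrightarrow> ((\<lambda>t. f (x + t *\<^sub>R b)) has_real_derivative d) (at 0)"

lemma has_pd_line:
  assumes "has_pd f b d (x + t *\<^sub>R b)"
  shows "((\<lambda>s. f (x + s *\<^sub>R b)) has_real_derivative d) (at t)"
  using assms DERIV_shift[of "\<lambda>s. f (x + s *\<^sub>R b)" d 0 t]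
  by (simp add: has_pd_def algebra_simps)

lemma has_pd_frechet:
  assumes "f differentiable (at x)"
  shows "has_pd f b (frechet_derivative f (at x) b) x"
proof -
  have f: "(f has_derivative frechet_derivative f (at x)) (at x)"
    using assms frechet_derivative_works by blast
  have l: "((\<lambda>t. x + t *\<^sub>R b) has_derivative (\<lambda>t. t *\<^sub>R b)) (at 0)"
    by (auto intro!: derivative_eq_intros)
  have "((\<lambda>t. f (x + t *\<^sub>R b)) has_derivative (\<lambda>t. frechet_derivative f (at x) (t *\<^sub>R b))) (at 0)"
    using has_derivative_compose[OF l, of f "frechet_derivative f (at x)"] f by simp
  moreover have "(\<lambda>t. frechet_derivative f (at x) (t *\<^sub>R b)) = (*) (frechet_derivative f (at x) b)"
    using linear_cmul[OF linear_frechet_derivative[OF assms]] by (intro ext) simp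
  ultimately show ?thesis
    unfolding has_pd_def has_field_derivative_def by simp
qed

lemma has_pd_inner_grad:
  fixes u :: "'a::euclidean_space \<Rightarrow> real"
  assumes "u differentiable (at x)"
  shows "has_pd u v (grad u x \<bullet> v) x"
proof -
  have lin: "linear (frechet_derivative u (at x))"
    using assms by (rule linear_frechet_derivative)
  have "frechet_derivative u (at x) v = frechet_derivative u (at x) (\<Sum>b\<in>Basis. (v \<bullet> b) *\<^sub>R b)"
    by (simp add: euclidean_representation)
  also have "\<dots> = grad u x \<bullet> v"
    by (simp add: linear_sum[OF lin] linear_cmul[OF lin] grad_def inner_sum_left inner_commute[of v] mult.commute)
  finally show ?thesis
    using has_pd_frechet[OF assms, of v] by simp
qed

lemma grad_inner_Basis:
  fixes u :: "'a::euclidean_space \<Rightarrow> real"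
  assumes "b \<in> Basis"
  shows "grad u x \<bullet> b = frechet_derivative u (at x) b"
  using assms by (simp add: grad_def inner_sum_left inner_Basis if_distrib cong: if_cong)

lemma has_pd_cong_open:
  assumes "open S" "x \<in> S" "\<And>y. y \<in> S \<Longrightarrow> f y = g y" "has_pd f b d x"
  shows "has_pd g b d x"
proof -
  have "((\<lambda>t. x + t *\<^sub>R b) \<longlongrightarrow> x + 0 *\<^sub>R b) (nhds 0)"
    by (intro tendsto_intros filterlim_ident)
  hence "\<forall>\<^sub>F t in nhds 0. x + t *\<^sub>R b \<in> S"
    using assms(1,2) by (simp add: tendsto_def)
  hence "\<forall>\<^sub>F t in nhds 0. f (x + t *\<^sub>R b) = g (x + t *\<^sub>R b)"
    by eventually_elim (use assms(3) in auto)
  thus ?thesis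
    using assms(4) DERIV_cong_ev[of 0 0 "\<lambda>t. f (x + t *\<^sub>R b)" "\<lambda>t. g (x + t *\<^sub>R b)" d d]
    by (simp add: has_pd_def)
qed

lemma has_pd_unique: "has_pd f b d x \<Longrightarrow> has_pd f b e x \<Longrightarrow> d = e"
  unfolding has_pd_def by (rule DERIV_unique)

lemma open_line_in:
  fixes b :: "'a::real_normed_vector"
  assumes "open S" "x \<in> S"
  obtains e where "e > 0" "\<And>t. \<bar>t\<bar> < e \<Longrightarrow> x + t *\<^sub>R b \<in> S"
proof -
  obtain r where r: "r > 0" "ball x r \<subseteq> S" using assms openE by blast
  show thesis
  \<comment> \<open>The added 1 covers \<open>b = 0\<close>.\<close>
  proof (rule that[of "r / (norm b + 1)"])
    show "r / (norm b + 1) > 0" using r by (simp add: add_nonneg_pos)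
    fix t assume "\<bar>t\<bar> < r / (norm b + 1)"
    hence "\<bar>t\<bar> * (norm b + 1) < r"
      by (simp add: add_nonneg_pos pos_less_divide_eq)
    moreover have "\<bar>t\<bar> * norm b \<le> \<bar>t\<bar> * (norm b + 1)" by (intro mult_left_mono) auto
    ultimately have "dist x (x + t *\<^sub>R b) < r" by (simp add: dist_norm)
    thus "x + t *\<^sub>R b \<in> S" using r by auto
  qed
qed

text \<open>If \<open>d\<close> were positive, \<open>w1\<close>, which vanishes at
  \<open>y\<close>, would be positive just beyond \<open>y\<close> along \<open>b\<close>, and
  \<open>w\<close> would increase strictly there.\<close>

lemma local_max_pd:
  assumes S: "open S" "y \<in> S" and max: "\<And>z. z \<in> S \<Longrightarrow> w z \<le> w y"
    and w1: "\<And>z. z \<in> S \<Longrightarrow> has_pd w b (w1 z) z" and w2: "has_pd w1 b d y"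
  shows "w1 y = 0" "d \<le> 0"
proof -
  obtain e where e: "e > 0" "\<And>t. \<bar>t\<bar> < e \<Longrightarrow> y + t *\<^sub>R b \<in> S"
    using open_line_in[OF S] by metis
  have der: "((\<lambda>s. w (y + s *\<^sub>R b)) has_real_derivative w1 (y + t *\<^sub>R b)) (at t)" if "\<bar>t\<bar> < e" for t
    by (rule has_pd_line) (rule w1[OF e(2)[OF that]])
  show w10: "w1 y = 0"
    using DERIV_local_max[OF der[of 0], of e] e max by auto
  show "d \<le> 0"
  proof (rule ccontr)
    assume "\<not> d \<le> 0"
    then obtain \<delta> where \<delta>: "\<delta> > 0" "\<And>h. h > 0 \<Longrightarrow> h < \<delta> \<Longrightarrow> w1 y < w1 (y + h *\<^sub>R b)"
      using DERIV_pos_inc_right[OF w2[unfolded has_pd_def]] by force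
    define r where "r = min \<delta> e / 2"
    have r: "r > 0" "r < \<delta>" "r < e" using \<delta> e by (auto simp: r_def)
    have "w (y + 0 *\<^sub>R b) < w (y + r *\<^sub>R b)"
    proof (rule DERIV_pos_imp_increasing_open[of 0 r "\<lambda>t. w (y + t *\<^sub>R b)"])
      fix t assume t: "0 < t" "t < r"
      show "\<exists>l. ((\<lambda>s. w (y + s *\<^sub>R b)) has_real_derivative l) (at t) \<and> l > 0"
        using der[of t] \<delta>(2)[of t] t r w10 by (intro exI[of _ "w1 (y + t *\<^sub>R b)"]) auto
    next
      show "continuous_on {0..r} (\<lambda>t. w (y + t *\<^sub>R b))"
        by (rule DERIV_atLeastAtMost_imp_continuous_on) (use der r in force)
    qed (use r in auto)
    moreover have "y + r *\<^sub>R b \<in> S" using e r by auto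
    ultimately show False using max[of "y + r *\<^sub>R b"] by auto
  qed
qed

text \<open>The mean value theorem is used twice: along \<open>b\<close> for the increment of
  \<open>f\<close> under the shift by \<open>h *\<^sub>R c\<close>, then along \<open>c\<close> for
  \<open>fb\<close>.\<close>

lemma second_difference_mean_value:
  assumes h: "h > 0" and in_S: "\<And>s t. 0 \<le> s \<Longrightarrow> s \<le> h \<Longrightarrow> 0 \<le> t \<Longrightarrow> t \<le> h \<Longrightarrow> x + s *\<^sub>R b + t *\<^sub>R c \<in> S"
    and fb: "\<And>y. y \<in> S \<Longrightarrow> has_pd f b (fb y) y"
    and fbc: "\<And>y. y \<in> S \<Longrightarrow> has_pd fb c (fbc y) y"
  shows "\<exists>s t. 0 \<le> s \<and> s \<le> h \<and> 0 \<le> t \<and> t \<le> h \<and>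
    f (x + h *\<^sub>R b + h *\<^sub>R c) - f (x + h *\<^sub>R b) - f (x + h *\<^sub>R c) + f x
      = h * h * fbc (x + s *\<^sub>R b + t *\<^sub>R c)"
proof -
  have d: "((\<lambda>s. f (x + s *\<^sub>R b + r *\<^sub>R c)) has_real_derivative fb (x + s *\<^sub>R b + r *\<^sub>R c)) (at s)"
    if "0 \<le> s" "s \<le> h" "0 \<le> r" "r \<le> h" for s r
    using has_pd_line[of f b "fb (x + s *\<^sub>R b + r *\<^sub>R c)" "x + r *\<^sub>R c" s] fb[OF in_S[OF that]]
    by (simp add: algebra_simps)
  have "\<exists>s. 0 < s \<and> s < h \<and> (f (x + h *\<^sub>R b + h *\<^sub>R c) - f (x + h *\<^sub>R b + 0 *\<^sub>R c))
      - (f (x + 0 *\<^sub>R b + h *\<^sub>R c) - f (x + 0 *\<^sub>R b + 0 *\<^sub>R c))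
      = (h - 0) * (fb (x + s *\<^sub>R b + h *\<^sub>R c) - fb (x + s *\<^sub>R b + 0 *\<^sub>R c))"
    by (rule MVT2, use h in simp, intro DERIV_diff d) (use h in auto)
  then obtain s where s: "0 < s" "s < h" "f (x + h *\<^sub>R b + h *\<^sub>R c) - f (x + h *\<^sub>R b) - f (x + h *\<^sub>R c) + f x
      = h * (fb (x + s *\<^sub>R b + h *\<^sub>R c) - fb (x + s *\<^sub>R b + 0 *\<^sub>R c))"
    by (auto simp: algebra_simps)
  have "\<exists>t. 0 < t \<and> t < h \<and> fb (x + s *\<^sub>R b + h *\<^sub>R c) - fb (x + s *\<^sub>R b + 0 *\<^sub>R c)
      = (h - 0) * fbc (x + s *\<^sub>R b + t *\<^sub>R c)"
    by (rule MVT2) (use h s in \<open>auto intro!: has_pd_line fbc in_S\<close>)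
  then obtain t where t: "0 < t" "t < h" "fb (x + s *\<^sub>R b + h *\<^sub>R c) - fb (x + s *\<^sub>R b + 0 *\<^sub>R c)
      = h * fbc (x + s *\<^sub>R b + t *\<^sub>R c)" by auto
  show ?thesis
    by (rule exI[of _ s], rule exI[of _ t]) (use s t in auto)
qed

text \<open>The second difference over a parallelogram is symmetric in \<open>b\<close> and
  \<open>c\<close>, and equals \<open>h * h\<close> times either mixed derivative at some nearby
  point. Continuity then compares the two values at \<open>x\<close>.\<close>

lemma has_pd_commute:
  fixes x b c :: "'a::real_normed_vector"
  assumes S: "open S" "x \<in> S"
    and fb: "\<And>y. y \<in> S \<Longrightarrow> has_pd f b (fb y) y" and fc: "\<And>y. y \<in> S \<Longrightarrow> has_pd f c (fc y) y"
    and fbc: "\<And>y. y \<in> S \<Longrightarrow> has_pd fb c (fbc y) y" and fcb: "\<And>y. y \<in> S \<Longrightarrow> has_pd fc b (fcb y) y"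
    and cont: "continuous_on S fbc" "continuous_on S fcb"
  shows "fbc x = fcb x"
proof (rule ccontr)
  assume ne: "fbc x \<noteq> fcb x"
  \<comment> \<open>Half the gap: no number lies strictly within \<open>e\<close> of both
    values.\<close>
  define e where "e = \<bar>fbc x - fcb x\<bar> / 2"
  have e: "e > 0" using ne by (simp add: e_def)
  have "isCont fbc x" "isCont fcb x" using cont S by (auto simp: continuous_on_eq_continuous_at)
  then obtain d1 d2 where d: "d1 > 0" "d2 > 0" "\<And>y. dist y x < d1 \<Longrightarrow> dist (fbc y) (fbc x) < e"
      "\<And>y. dist y x < d2 \<Longrightarrow> dist (fcb y) (fcb x) < e"
    unfolding continuous_at_eps_delta using e by metis
  obtain r where r: "r > 0" "ball x r \<subseteq> S" using S openE by blast
  define \<rho> where "\<rho> = min r (min d1 d2)"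
  have \<rho>: "\<rho> > 0" using d r by (simp add: \<rho>_def)
  \<comment> \<open>Keeps the whole parallelogram in the ball of radius \<rho>; the added 1 covers
    vanishing \<open>b\<close> and \<open>c\<close>.\<close>
  define h where "h = \<rho> / (2 * (norm b + norm c + 1))"
  have h: "h > 0" using \<rho> by (simp add: h_def add_nonneg_pos)
  have near: "dist (x + s *\<^sub>R b + t *\<^sub>R c) x < \<rho>" if "0 \<le> s" "s \<le> h" "0 \<le> t" "t \<le> h" for s t
  proof -
    have "dist (x + s *\<^sub>R b + t *\<^sub>R c) x = norm (s *\<^sub>R b + t *\<^sub>R c)" by (simp add: dist_norm algebra_simps)
    also have "\<dots> \<le> s * norm b + t * norm c"
      using norm_triangle_ineq[of "s *\<^sub>R b" "t *\<^sub>R c"] that by simp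
    also have "\<dots> \<le> h * norm b + h * norm c"
      using that by (intro add_mono mult_right_mono) auto
    also have "\<dots> < h * (2 * (norm b + norm c + 1))"
    proof -
      have "0 \<le> h * norm b" "0 \<le> h * norm c" using h by auto
      thus ?thesis unfolding distrib_left mult_2 using h by linarith
    qed
    also have "\<dots> = \<rho>"
    proof -
      have "norm b + norm c + 1 \<noteq> 0" by (smt (verit) norm_ge_zero)
      thus ?thesis by (simp add: h_def)
    qed
    finally show ?thesis .
  qed
  have in_S: "x + s *\<^sub>R b + t *\<^sub>R c \<in> S" if "0 \<le> s" "s \<le> h" "0 \<le> t" "t \<le> h" for s t
    using near[OF that] r by (auto simp: \<rho>_def dist_commute)
  obtain s t where st: "0 \<le> s" "s \<le> h" "0 \<le> t" "t \<le> h"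
    "f (x + h *\<^sub>R b + h *\<^sub>R c) - f (x + h *\<^sub>R b) - f (x + h *\<^sub>R c) + f x
      = h * h * fbc (x + s *\<^sub>R b + t *\<^sub>R c)"
    using second_difference_mean_value[where S = S and x = x and b = b and c = c, OF h in_S fb fbc] by blast
  have in_S': "x + s *\<^sub>R c + t *\<^sub>R b \<in> S" if "0 \<le> s" "s \<le> h" "0 \<le> t" "t \<le> h" for s t
    using in_S[of t s] that by (simp add: algebra_simps)
  obtain s' t' where st': "0 \<le> s'" "s' \<le> h" "0 \<le> t'" "t' \<le> h"
    "f (x + h *\<^sub>R c + h *\<^sub>R b) - f (x + h *\<^sub>R c) - f (x + h *\<^sub>R b) + f x
      = h * h * fcb (x + s' *\<^sub>R c + t' *\<^sub>R b)"
    using second_difference_mean_value[where S = S and x = x and b = c and c = b, OF h in_S' fc fcb] by blast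
  have "h * h * fbc (x + s *\<^sub>R b + t *\<^sub>R c) = h * h * fcb (x + t' *\<^sub>R b + s' *\<^sub>R c)"
    using st(5) st'(5) by (simp add: algebra_simps)
  hence "fbc (x + s *\<^sub>R b + t *\<^sub>R c) = fcb (x + t' *\<^sub>R b + s' *\<^sub>R c)" using h by simp
  moreover have "dist (fbc (x + s *\<^sub>R b + t *\<^sub>R c)) (fbc x) < e"
    using near[OF st(1-4)] by (intro d) (auto simp: \<rho>_def)
  moreover have "dist (fcb (x + t' *\<^sub>R b + s' *\<^sub>R c)) (fcb x) < e"
    using near[OF st'(3,4,1,2)] by (intro d) (auto simp: \<rho>_def)
  ultimately show False unfolding e_def dist_real_def by argo
qed

text \<open>The function \<open>(h t)\<^sup>2 * exp (- 2 * C * t)\<close> is non-increasing and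
  starts at 0.\<close>

lemma gronwall_vanish:
  fixes h :: "real \<Rightarrow> real"
  assumes cont: "continuous_on {0..1} h"
    and der: "\<And>t. 0 < t \<Longrightarrow> t < 1 \<Longrightarrow> (h has_real_derivative h' t) (at t)"
    and le: "\<And>t. 0 < t \<Longrightarrow> t < 1 \<Longrightarrow> \<bar>h' t\<bar> \<le> C * \<bar>h t\<bar>" and "h 0 = 0"
  shows "h 1 = 0"
proof -
  have "(h 0)\<^sup>2 * exp (- 2 * C * 0) \<ge> (h 1)\<^sup>2 * exp (- 2 * C * 1)"
  proof (rule DERIV_nonpos_imp_decreasing_open[of 0 1 "\<lambda>t. (h t)\<^sup>2 * exp (- 2 * C * t)"])
    fix t :: real assume t: "0 < t" "t < 1"
    have "((\<lambda>t. (h t)\<^sup>2 * exp (- 2 * C * t)) has_real_derivative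
        (2 * (h t * h' t - C * (h t)\<^sup>2)) * exp (- 2 * C * t)) (at t)"
      by (auto intro!: derivative_eq_intros der t simp: algebra_simps power2_eq_square)
    moreover have "h t * h' t \<le> C * (h t)\<^sup>2"
    proof -
      have "h t * h' t \<le> \<bar>h t\<bar> * \<bar>h' t\<bar>" by (metis abs_ge_self abs_mult)
      also have "\<dots> \<le> \<bar>h t\<bar> * (C * \<bar>h t\<bar>)" by (intro mult_left_mono le t) auto
      finally show ?thesis by (simp add: power2_eq_square algebra_simps)
    qed
    ultimately show "\<exists>y. ((\<lambda>t. (h t)\<^sup>2 * exp (- 2 * C * t)) has_real_derivative y) (at t) \<and> y \<le> 0"
      by (intro exI conjI) (auto simp: mult_le_0_iff)
  qed (auto intro!: continuous_intros cont)
  thus ?thesis using \<open>h 0 = 0\<close> by (simp add: mult_le_0_iff not_less)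
qed

lemma has_pd_compose:
  assumes "(\<phi> has_real_derivative d) (at (w x))" "has_pd w b e x"
  shows "has_pd (\<lambda>y. \<phi> (w y)) b (d * e) x"
  using assms DERIV_chain2[of \<phi> d "\<lambda>t. w (x + t *\<^sub>R b)" 0 e UNIV] by (simp add: has_pd_def)

lemma has_pd_add_scaled:
  assumes "has_pd p b d x" "has_pd q b e x"
  shows "has_pd (\<lambda>y. p y + c * q y) b (d + c * e) x"
  using assms unfolding has_pd_def by (auto intro!: derivative_eq_intros)

section \<open>The strong maximum principle\<close>

lemma has_pd_dist_squared:
  fixes x :: "'a::real_inner"
  shows "has_pd (\<lambda>y. (norm (y - c))\<^sup>2) b (2 * ((x - c) \<bullet> b)) x"
proof -
  have "(\<lambda>t. (norm (x + t *\<^sub>R b - c))\<^sup>2) = (\<lambda>t. (norm (x - c))\<^sup>2 + 2 * ((x - c) \<bullet> b) * t + (norm b)\<^sup>2 * t\<^sup>2)"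
  proof
    fix t
    have "x + t *\<^sub>R b - c = (x - c) + t *\<^sub>R b" by simp
    thus "(norm (x + t *\<^sub>R b - c))\<^sup>2 = (norm (x - c))\<^sup>2 + 2 * ((x - c) \<bullet> b) * t + (norm b)\<^sup>2 * t\<^sup>2"
      unfolding power2_norm_eq_inner
      by (simp only: inner_add_left inner_add_right inner_scaleR_left inner_scaleR_right inner_commute[of b "x - c"])
        (simp add: power2_eq_square algebra_simps del: dot_square_norm)
  qed
  thus ?thesis unfolding has_pd_def by (auto intro!: derivative_eq_intros)
qed

text \<open>Derivatives of Hopf's barrier; the constant \<open>k\<close> serves to make it vanish on
  a chosen sphere.\<close>

lemma has_pd_gaussian:
  fixes x :: "'a::real_inner"
  shows "has_pd (\<lambda>y. exp (- a * (norm (y - c))\<^sup>2) - k) b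
      (- 2 * a * ((x - c) \<bullet> b) * exp (- a * (norm (x - c))\<^sup>2)) x"
    and "norm b = 1 \<Longrightarrow> has_pd (\<lambda>y. - 2 * a * ((y - c) \<bullet> b) * exp (- a * (norm (y - c))\<^sup>2)) b
      ((4 * a\<^sup>2 * ((x - c) \<bullet> b)\<^sup>2 - 2 * a) * exp (- a * (norm (x - c))\<^sup>2)) x"
proof -
  have d: "((\<lambda>t. (norm (x + t *\<^sub>R b - c))\<^sup>2) has_real_derivative 2 * ((x - c) \<bullet> b)) (at 0)"
    using has_pd_dist_squared[of c b x] by (simp add: has_pd_def)
  show "has_pd (\<lambda>y. exp (- a * (norm (y - c))\<^sup>2) - k) b
      (- 2 * a * ((x - c) \<bullet> b) * exp (- a * (norm (x - c))\<^sup>2)) x"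
    unfolding has_pd_def
    by (rule DERIV_cong, rule DERIV_diff[OF DERIV_fun_exp[OF DERIV_cmult[OF d]] DERIV_const]) simp
  assume "norm b = 1"
  hence "b \<bullet> b = 1" by (simp add: norm_eq_1)
  hence l: "((\<lambda>t. (x + t *\<^sub>R b - c) \<bullet> b) has_real_derivative 1) (at 0)"
    by (auto simp: inner_simps intro!: derivative_eq_intros)
  show "has_pd (\<lambda>y. - 2 * a * ((y - c) \<bullet> b) * exp (- a * (norm (y - c))\<^sup>2)) b
      ((4 * a\<^sup>2 * ((x - c) \<bullet> b)\<^sup>2 - 2 * a) * exp (- a * (norm (x - c))\<^sup>2)) x"
    unfolding has_pd_def
    by (rule DERIV_cong, rule DERIV_mult[OF DERIV_cmult[OF l] DERIV_fun_exp[OF DERIV_cmult[OF d]]])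
      (simp add: algebra_simps power2_eq_square)
qed

lemma sum_Basis_inner_squared: "(\<Sum>b\<in>Basis. (x \<bullet> b)\<^sup>2) = (norm x)\<^sup>2"
  using euclidean_inner[of x x] by (simp only: power2_norm_eq_inner) (simp only: power2_eq_square)

lemma sum_Basis_inner_mult: "(\<Sum>b\<in>Basis. (x \<bullet> b) * (y \<bullet> b)) = x \<bullet> y"
  by (simp add: euclidean_inner[of x y])

text \<open>The ball with centre \<open>c\<close> is internally tangent at \<open>y\<close> to the sphere through \<open>y\<close> with
  centre \<open>z\<close>.\<close>

lemma inner_tangent_ball:
  fixes z y q :: "'a::real_inner"
  defines "c \<equiv> z + (1/2) *\<^sub>R (y - z)"
  assumes q: "dist c q \<le> dist z y / 2" "q \<noteq> y"
  shows "dist z q < dist z y"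
proof -
  define v w where "v = q - z" and "w = (1/2) *\<^sub>R (y - z)"
  have nw: "norm w = dist z y / 2" by (simp add: w_def dist_norm norm_minus_commute)
  have "c - q = w - v" by (simp add: c_def v_def w_def)
  hence "norm (v - w) \<le> norm w" using q nw by (simp add: dist_norm norm_minus_commute)
  hence "(norm (v - w))\<^sup>2 \<le> (norm w)\<^sup>2" by (intro power_mono) auto
  hence 1: "v \<bullet> v \<le> 2 * (v \<bullet> w)" by (simp add: power2_norm_eq_inner inner_simps inner_commute)
  have "v - 2 *\<^sub>R w \<noteq> 0" using q(2) by (simp add: v_def w_def)
  hence 2: "0 < (v - 2 *\<^sub>R w) \<bullet> (v - 2 *\<^sub>R w)" unfolding inner_gt_zero_iff .
  have "(v - 2 *\<^sub>R w) \<bullet> (v - 2 *\<^sub>R w) = v \<bullet> v - 4 * (v \<bullet> w) + 4 * (w \<bullet> w)"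
    by (simp add: inner_simps inner_commute)
  hence "v \<bullet> v < (2 *\<^sub>R w) \<bullet> (2 *\<^sub>R w)" using 1 2 by simp
  hence "norm v < norm (2 *\<^sub>R w)" by (simp only: norm_lt)
  thus ?thesis using nw by (simp add: v_def dist_norm norm_minus_commute)
qed

text \<open>Hopf's argument at a point \<open>y\<close> where \<open>p = m\<close>: a barrier that
  vanishes at \<open>y\<close> and is a strict subsolution nearby is added to \<open>p\<close>. The
  sum is larger at \<open>y\<close> than on a small sphere around it, hence has an interior maximum,
  where the differential inequality fails.\<close>

lemma strong_maximum_principle_local:
  fixes p :: "'a::euclidean_space \<Rightarrow> real" and B :: "'a \<Rightarrow> 'a"
  assumes S: "open S" "x0 \<in> S" and cont: "continuous_on S p"
    and p1: "\<And>x b. x \<in> S \<Longrightarrow> b \<in> Basis \<Longrightarrow> has_pd p b (p1 b x) x"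
    and p2: "\<And>x b. x \<in> S \<Longrightarrow> b \<in> Basis \<Longrightarrow> has_pd (p1 b) b (p2 b x) x"
    and sub: "\<And>x. x \<in> S \<Longrightarrow> 0 \<le> (\<Sum>b\<in>Basis. p2 b x) + (\<Sum>b\<in>Basis. (B x \<bullet> b) * p1 b x)"
    and B: "\<And>x. x \<in> S \<Longrightarrow> norm (B x) \<le> K"
    and le: "\<And>x. x \<in> S \<Longrightarrow> p x \<le> m" and eq: "p x0 = m"
  shows "\<exists>r>0. ball x0 r \<subseteq> S \<and> (\<forall>x\<in>ball x0 r. p x = m)"
proof -
  obtain r' where r': "r' > 0" "cball x0 r' \<subseteq> S" using S open_contains_cball by blast
  \<comment> \<open>A third leaves room for a contact point within \<open>2 * r\<close> of
    \<open>x0\<close> and for a ball around it.\<close>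
  define r where "r = r' / 3"
  have r: "r > 0" "cball x0 (3 * r) \<subseteq> S" using r' by (auto simp: r_def)
  have "p z = m" if z: "z \<in> ball x0 r" for z
  proof (rule ccontr)
    assume "p z \<noteq> m"
    have zS: "z \<in> S" using z r by (auto simp: subset_iff)
    define A where "A = {y \<in> cball x0 (2 * r). p y = m}"
    have 2: "cball x0 (2 * r) \<subseteq> S" using r by (auto simp: subset_iff)
    have "continuous_on (cball x0 (2 * r)) p" using cont 2 by (rule continuous_on_subset)
    hence A: "closed A" unfolding A_def
      using continuous_closed_preimage_constant[of "cball x0 (2*r)" p m] by simp
    have "x0 \<in> A" using eq r by (simp add: A_def)
    \<comment> \<open>The contact point nearest to \<open>z\<close>, so that \<open>p < m\<close> on
      the open ball around \<open>z\<close> with \<open>y\<close> on its boundary.\<close>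
    then obtain y where y: "y \<in> A" "\<And>q. q \<in> A \<Longrightarrow> dist z y \<le> dist z q"
      using distance_attains_inf[OF A, of z] by auto
    have py: "p y = m" using y(1) by (simp add: A_def)
    define \<rho> where "\<rho> = dist z y"
    have "\<rho> \<noteq> 0" using py \<open>p z \<noteq> m\<close> by (auto simp: \<rho>_def)
    hence \<rho>: "\<rho> > 0" by (simp add: \<rho>_def)
    have "\<rho> < r" using y(2)[OF \<open>x0 \<in> A\<close>] z by (simp add: \<rho>_def dist_commute)
    have inner: "p q < m" if "dist z q < \<rho>" for q
    proof -
      have "dist x0 q < 2 * r" using dist_triangle[of x0 q z] z that \<open>\<rho> < r\<close> by simp
      hence q: "q \<in> cball x0 (2 * r)" by simp
      moreover have "q \<notin> A" using y(2)[of q] that by (auto simp: \<rho>_def)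
      ultimately have "p q \<noteq> m" by (simp add: A_def)
      moreover have "p q \<le> m" using le q 2 by blast
      ultimately show ?thesis by simp
    qed
    \<comment> \<open>Halving the ball towards \<open>y\<close> makes \<open>y\<close> the only
      contact point on the closed ball.\<close>
    define c where "c = z + (1/2) *\<^sub>R (y - z)"
    have cy: "dist c y = \<rho> / 2"
    proof -
      have "c - y = (- 1/2) *\<^sub>R (y - z)" unfolding c_def by (simp add: algebra_simps flip: scaleR_add_left)
      thus ?thesis by (simp add: dist_norm \<rho>_def norm_minus_commute)
    qed
    have inner': "p q < m" if "dist c q \<le> \<rho> / 2" "q \<noteq> y" for q
      using inner inner_tangent_ball[of z y q] that unfolding c_def \<rho>_def by blast
    \<comment> \<open>Half the radius of the tangent ball: on \<open>cball y s\<close> the distance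
      to \<open>c\<close> stays between \<open>s\<close> and \<open>3 * s\<close>, away from the
      centre, where the barrier is no subsolution.\<close>
    define s where "s = \<rho> / 4"
    have s: "s > 0" using \<rho> by (simp add: s_def)
    have cbS: "cball y s \<subseteq> S"
    proof
      fix q assume "q \<in> cball y s"
      hence "dist x0 q \<le> dist x0 z + \<rho> + s"
        using dist_triangle[of x0 q z] dist_triangle[of z q y] by (simp add: \<rho>_def)
      also have "\<dots> < 3 * r" using z \<open>\<rho> < r\<close> \<rho> by (simp add: s_def)
      finally show "q \<in> S" using r by auto
    qed
    have yS: "y \<in> S" using cbS s by auto
    have K: "K \<ge> 0" using B[OF yS] norm_ge_zero[of "B y"] by linarith
    define n where "n = real DIM('a)"
    \<comment> \<open>Makes \<open>2 * a * s\<^sup>2\<close> exceed the dimension term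
      \<open>n\<close> plus the largest drift \<open>3 * K * s\<close>.\<close>
    define a where "a = (n + 3 * K * s + 1) / (2 * s\<^sup>2)"
    have a: "a > 0" using K s by (simp add: a_def n_def add_nonneg_pos)
    have as: "2 * a * s\<^sup>2 = n + 3 * K * s + 1" using s by (simp add: a_def)
    define E where "E = (\<lambda>x. exp (- a * (norm (x - c))\<^sup>2))"
    define h where "h = (\<lambda>x. exp (- a * (norm (x - c))\<^sup>2) - exp (- a * (\<rho> / 2)\<^sup>2))"
    define h1 where "h1 = (\<lambda>b x. - 2 * a * ((x - c) \<bullet> b) * exp (- a * (norm (x - c))\<^sup>2))"
    define h2 where "h2 = (\<lambda>b x. (4 * a\<^sup>2 * ((x - c) \<bullet> b)\<^sup>2 - 2 * a) * exp (- a * (norm (x - c))\<^sup>2))"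
    have hd: "has_pd h b (h1 b x) x" "b \<in> Basis \<Longrightarrow> has_pd (h1 b) b (h2 b x) x" for b x
      unfolding h_def h1_def h2_def by (rule has_pd_gaussian, rule has_pd_gaussian, rule norm_Basis)
    have Lh: "0 < (\<Sum>b\<in>Basis. h2 b x) + (\<Sum>b\<in>Basis. (B x \<bullet> b) * h1 b x)" if x: "x \<in> cball y s" for x
    proof -
      have "(\<Sum>b\<in>Basis. h2 b x) = (4 * a\<^sup>2 * (norm (x - c))\<^sup>2 - 2 * a * n) * E x"
        by (simp add: h2_def E_def n_def sum_Basis_inner_squared[of "x - c", symmetric]
            sum_subtractf sum_distrib_left sum_distrib_right left_diff_distrib)
      moreover have "(\<Sum>b\<in>Basis. (B x \<bullet> b) * h1 b x) = (- 2 * a * (B x \<bullet> (x - c))) * E x"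
        by (simp add: h1_def E_def sum_Basis_inner_mult[of "B x" "x - c", symmetric] sum_distrib_left
            sum_distrib_right sum_negf mult_ac)
      moreover have "s \<le> norm (x - c)"
        using x cy dist_triangle[of c y x] by (simp add: dist_norm norm_minus_commute s_def)
      moreover have "norm (x - c) \<le> 3 * s"
        using x cy dist_triangle[of c x y] by (simp add: dist_norm norm_minus_commute s_def)
      ultimately have h: "(\<Sum>b\<in>Basis. h2 b x) + (\<Sum>b\<in>Basis. (B x \<bullet> b) * h1 b x)
          = 2 * a * (2 * a * (norm (x - c))\<^sup>2 - n - B x \<bullet> (x - c)) * E x"
        and "s\<^sup>2 \<le> (norm (x - c))\<^sup>2" "norm (x - c) \<le> 3 * s"
        using s by (auto simp: algebra_simps power2_eq_square intro: mult_mono)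
      hence "2 * a * s\<^sup>2 \<le> 2 * a * (norm (x - c))\<^sup>2" using a by simp
      moreover have "B x \<bullet> (x - c) \<le> K * (3 * s)"
      proof -
        have "B x \<bullet> (x - c) \<le> norm (B x) * norm (x - c)" by (rule norm_cauchy_schwarz)
        also have "\<dots> \<le> K * (3 * s)"
          using B[of x] cbS x \<open>norm (x - c) \<le> 3 * s\<close> K by (intro mult_mono) auto
        finally show ?thesis .
      qed
      ultimately have "0 < 2 * a * (norm (x - c))\<^sup>2 - n - B x \<bullet> (x - c)" using as by linarith
      thus ?thesis unfolding h E_def using a by simp
    qed
    \<comment> \<open>This part of the small sphere is compact and misses \<open>y\<close>, so
      \<open>p\<close> stays below \<open>m\<close> by a fixed amount there.\<close>
    define T where "T = sphere y s \<inter> cball c (\<rho> / 2)"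
    obtain m1 where m1: "m1 < m" "\<And>q. q \<in> T \<Longrightarrow> p q \<le> m1"
    proof (cases "T = {}")
      case True
      thus thesis using that[of "m - 1"] by simp
    next
      case False
      have "compact T" unfolding T_def by (intro compact_Int compact_sphere compact_cball)
      moreover have "continuous_on T p" by (rule continuous_on_subset[OF cont]) (use cbS in \<open>auto simp: T_def\<close>)
      ultimately obtain q where q: "q \<in> T" "\<forall>x\<in>T. p x \<le> p q"
        using continuous_attains_sup False by blast
      have "q \<noteq> y" using q(1) s by (auto simp: T_def)
      hence "p q < m" using inner'[of q] q(1) by (simp add: T_def)
      thus thesis using that q by blast
    qed
    \<comment> \<open>As the barrier is at most 1, the sum stays at or below
      \<open>m1 + \<epsilon> < m\<close> on \<open>T\<close>.\<close>
    define \<epsilon> where "\<epsilon> = (m - m1) / 2"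
    have \<epsilon>: "\<epsilon> > 0" using m1 by (simp add: \<epsilon>_def)
    define w where "w = (\<lambda>x. p x + \<epsilon> * h x)"
    have "norm (y - c) = \<rho> / 2" using cy by (simp add: dist_norm norm_minus_commute)
    hence "h y = 0" unfolding h_def by (simp only: diff_self)
    hence wy: "w y = m" using py by (simp add: w_def)
    have "continuous_on (cball y s) w"
      unfolding w_def h_def by (intro continuous_intros continuous_on_subset[OF cont cbS])
    then obtain q where q: "q \<in> cball y s" "\<And>x. x \<in> cball y s \<Longrightarrow> w x \<le> w q"
      using continuous_attains_sup[of "cball y s" w] s by auto
    have wq: "m \<le> w q" using q(2)[of y] wy s by simp
    \<comment> \<open>On the small sphere \<open>w < m\<close>: on \<open>T\<close> by the choice of
      \<epsilon>, elsewhere because the barrier is negative outside the tangent ball.\<close>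
    have "q \<notin> sphere y s"
    proof
      assume qs: "q \<in> sphere y s"
      show False
      proof (cases "dist c q \<le> \<rho> / 2")
        case True
        hence "p q \<le> m1" using m1 qs by (simp add: T_def)
        moreover have "h q \<le> 1"
          using a by (simp add: h_def) (smt (verit) exp_ge_zero exp_le_one_iff mult_nonneg_nonneg zero_le_power2)
        ultimately have "w q \<le> m1 + \<epsilon>" using \<epsilon> by (auto simp: w_def intro: add_mono)
        thus False using wq m1(1) by (simp add: \<epsilon>_def field_simps)
      next
        case False
        hence "(\<rho> / 2)\<^sup>2 < (norm (q - c))\<^sup>2"
          using \<rho> by (intro power_strict_mono) (auto simp: dist_norm norm_minus_commute)
        hence "h q < 0" using a by (simp add: h_def)
        moreover have "p q \<le> m" using le q cbS by blast
        ultimately show False using wq \<epsilon> by (smt (verit) w_def mult_pos_neg)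
      qed
    qed
    hence qb: "q \<in> ball y s" using q(1) by auto
    have bS: "ball y s \<subseteq> S" using cbS by auto
    have max: "p1 b q + \<epsilon> * h1 b q = 0" "p2 b q + \<epsilon> * h2 b q \<le> 0" if b: "b \<in> Basis" for b
    proof -
      have 1: "has_pd w b (p1 b x + \<epsilon> * h1 b x) x" if "x \<in> ball y s" for x
        unfolding w_def using that bS b by (intro has_pd_add_scaled p1 hd) auto
      have 2: "has_pd (\<lambda>x. p1 b x + \<epsilon> * h1 b x) b (p2 b q + \<epsilon> * h2 b q) q"
        using qb bS b by (intro has_pd_add_scaled p2 hd) auto
      show "p1 b q + \<epsilon> * h1 b q = 0" "p2 b q + \<epsilon> * h2 b q \<le> 0"
        using local_max_pd[of "ball y s" q w b "\<lambda>x. p1 b x + \<epsilon> * h1 b x", OF _ qb _ 1 2] q(2) by auto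
    qed
    have "(\<Sum>b\<in>Basis. p2 b q + \<epsilon> * h2 b q) + (\<Sum>b\<in>Basis. (B q \<bullet> b) * (p1 b q + \<epsilon> * h1 b q)) \<le> 0"
      using max by (simp add: sum_nonpos)
    hence "((\<Sum>b\<in>Basis. p2 b q) + (\<Sum>b\<in>Basis. (B q \<bullet> b) * p1 b q))
        + \<epsilon> * ((\<Sum>b\<in>Basis. h2 b q) + (\<Sum>b\<in>Basis. (B q \<bullet> b) * h1 b q)) \<le> 0"
      by (simp add: sum.distrib distrib_left sum_distrib_left mult_ac)
    moreover have "0 < \<epsilon> * ((\<Sum>b\<in>Basis. h2 b q) + (\<Sum>b\<in>Basis. (B q \<bullet> b) * h1 b q))"
      using Lh[OF q(1)] \<epsilon> by simp
    moreover have "q \<in> S" using q(1) cbS by auto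
    ultimately show False using sub[of q] by linarith
  qed
  moreover have "ball x0 r \<subseteq> S" using r by (auto simp: subset_iff)
  ultimately show ?thesis using r by blast
qed

section \<open>The Bochner inequality\<close>

lemma Ck_on_Suc_continuous: "Ck_on (Suc k) f S \<Longrightarrow> continuous_on S f"
  by (auto intro!: continuous_at_imp_continuous_on differentiable_imp_continuous_within)

lemma Ck_on_SucD:
  assumes "Ck_on (Suc k) f S"
  shows "x \<in> S \<Longrightarrow> f differentiable (at x)" "Ck_on k (\<lambda>x. frechet_derivative f (at x) v) S"
  using assms by auto

text \<open>Passes from the Frechet-based \<open>Ck_on\<close> to ordinary derivatives:
  \<open>deriv g t\<close> is the Frechet derivative at \<open>t\<close> applied to 1.\<close>

lemma Ck_on_2_real:
  fixes F :: "real \<Rightarrow> real"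
  assumes "Ck_on 2 F UNIV"
  shows "(F has_real_derivative deriv F t) (at t)"
    and "(deriv F has_real_derivative deriv (deriv F) t) (at t)"
    and "continuous_on UNIV (deriv (deriv F))"
proof -
  have *: "deriv g = (\<lambda>t. frechet_derivative g (at t) 1)" "(g has_real_derivative deriv g t) (at t)"
    if "\<And>t. g differentiable (at t)" for g :: "real \<Rightarrow> real" and t
  proof -
    have d: "(g has_real_derivative frechet_derivative g (at t) 1) (at t)" for t
      using has_pd_line[where x = 0 and b = 1 and t = t, OF has_pd_frechet[OF that]] by simp
    show "deriv g = (\<lambda>t. frechet_derivative g (at t) 1)" using DERIV_imp_deriv[OF d] by blast
    thus "(g has_real_derivative deriv g t) (at t)" using d by simp
  qed
  have 1: "Ck_on (Suc (Suc 0)) F UNIV" using assms by (simp add: numeral_2_eq_2)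
  note F = Ck_on_SucD(1)[OF 1 UNIV_I]
  show "(F has_real_derivative deriv F t) (at t)" using *(2)[OF F] .
  have 2: "Ck_on (Suc 0) (deriv F) UNIV" unfolding *(1)[OF F] by (rule Ck_on_SucD(2)[OF 1])
  note F' = Ck_on_SucD(1)[OF 2 UNIV_I]
  show "(deriv F has_real_derivative deriv (deriv F) t) (at t)" using *(2)[OF F'] .
  show "continuous_on UNIV (deriv (deriv F))"
    using Ck_on_SucD(2)[OF 2, of 1] unfolding *(1)[OF F'] by simp
qed

text \<open>Collects the interior data; sign, upper bound and boundary values of \<open>u\<close>
  enter the individual lemmas as assumptions.\<close>

locale semilinear_equation =
  fixes \<Omega> :: "'a::euclidean_space set" and F f :: "real \<Rightarrow> real" and u :: "'a \<Rightarrow> real"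
  assumes open_dom: "open \<Omega>" and F_C2: "Ck_on 2 F UNIV" and F_nonpos: "F t \<le> 0"
    and f_def: "f = deriv F" and u_C3: "Ck_on 3 u \<Omega>"
    and equation: "x \<in> \<Omega> \<Longrightarrow> laplacian u x + f (u x) = 0"
begin

text \<open>The directions in \<open>U2\<close> and \<open>U3\<close> stand in the order of
  differentiation, so their symmetry has to be proved.\<close>

definition U :: "'a \<Rightarrow> 'a \<Rightarrow> real" where "U b x = frechet_derivative u (at x) b"
definition U2 :: "'a \<Rightarrow> 'a \<Rightarrow> 'a \<Rightarrow> real" where "U2 b c x = frechet_derivative (U b) (at x) c"
definition U3 :: "'a \<Rightarrow> 'a \<Rightarrow> 'a \<Rightarrow> 'a \<Rightarrow> real" where "U3 b c d x = frechet_derivative (U2 b c) (at x) d"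

abbreviation P :: "'a \<Rightarrow> real" where "P \<equiv> P_function F u"

text \<open>\<open>P1\<close> and \<open>P2\<close> come from the product and chain rules. They are
  written out because the third derivatives in \<open>P2\<close> have to be eliminated through the
  equation.\<close>

definition P1 :: "'a \<Rightarrow> 'a \<Rightarrow> real" where
  "P1 b x = 2 * (\<Sum>i\<in>Basis. U i x * U2 i b x) + 2 * (f (u x) * U b x)"
definition P2 :: "'a \<Rightarrow> 'a \<Rightarrow> real" where
  "P2 b x = 2 * (\<Sum>i\<in>Basis. (U2 i b x)\<^sup>2 + U i x * U3 i b b x)
    + 2 * (deriv f (u x) * (U b x)\<^sup>2 + f (u x) * U2 b b x)"

lemma F_deriv: "(F has_real_derivative f t) (at t)"
  and f_deriv: "(f has_real_derivative deriv f t) (at t)"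
  and deriv_f_cont: "continuous_on UNIV (deriv f)"
  using Ck_on_2_real[OF F_C2] by (simp_all add: f_def)

lemma f_cont: "continuous_on UNIV f" and F_cont: "continuous_on UNIV F"
  using f_deriv F_deriv by (auto intro!: continuous_at_imp_continuous_on DERIV_isCont)

section \<open>Partial derivatives of \<open>u\<close> up to order three\<close>

lemma u_C3_Suc: "Ck_on (Suc (Suc (Suc 0))) u \<Omega>"
  using u_C3 by (simp add: numeral_3_eq_3)

lemma U_C2: "Ck_on (Suc (Suc 0)) (U b) \<Omega>"
  unfolding U_def by (rule Ck_on_SucD(2)[OF u_C3_Suc])

lemma U2_C1: "Ck_on (Suc 0) (U2 b c) \<Omega>"
  unfolding U2_def by (rule Ck_on_SucD(2)[OF U_C2])

lemma U3_cont: "continuous_on \<Omega> (U3 b c d)"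
  using Ck_on_SucD(2)[OF U2_C1, of b c d] by (simp add: U3_def[abs_def])

lemma U2_cont: "continuous_on \<Omega> (U2 b c)"
  using U2_C1 by (rule Ck_on_Suc_continuous)

lemma U_cont: "continuous_on \<Omega> (U b)"
  using U_C2 by (rule Ck_on_Suc_continuous)

lemma u_cont: "continuous_on \<Omega> u"
  using u_C3_Suc by (rule Ck_on_Suc_continuous)

lemma u_differentiable: "x \<in> \<Omega> \<Longrightarrow> u differentiable (at x)"
  by (rule Ck_on_SucD(1)[OF u_C3_Suc])

lemma has_pd_u: "x \<in> \<Omega> \<Longrightarrow> has_pd u b (U b x) x"
  unfolding U_def by (intro has_pd_frechet u_differentiable)

lemma has_pd_U: "x \<in> \<Omega> \<Longrightarrow> has_pd (U b) c (U2 b c x) x"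
  unfolding U2_def by (intro has_pd_frechet Ck_on_SucD(1)[OF U_C2])

lemma has_pd_U2: "x \<in> \<Omega> \<Longrightarrow> has_pd (U2 b c) d (U3 b c d x) x"
  unfolding U3_def by (intro has_pd_frechet Ck_on_SucD(1)[OF U2_C1])

lemma U2_commute: "x \<in> \<Omega> \<Longrightarrow> U2 b c x = U2 c b x"
  by (rule has_pd_commute[OF open_dom _ has_pd_u has_pd_u has_pd_U has_pd_U U2_cont U2_cont])

text \<open>Swapping the first two directions and then the last two moves \<open>i\<close> to the
  end, where it differentiates a term of the Laplacian.\<close>

lemma U3_commute:
  assumes "x \<in> \<Omega>"
  shows "U3 i j j x = U3 j j i x"
proof -
  have "has_pd (U2 j i) j (U3 i j j x) x"
    by (rule has_pd_cong_open[OF open_dom assms _ has_pd_U2[OF assms]]) (rule U2_commute)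
  hence "U3 i j j x = U3 j i j x" using has_pd_U2[OF assms] has_pd_unique by blast
  also have "\<dots> = U3 j j i x"
    by (rule has_pd_commute[OF open_dom assms has_pd_U has_pd_U has_pd_U2 has_pd_U2 U3_cont U3_cont])
  finally show ?thesis .
qed

lemma laplacian_eq: "laplacian u x = (\<Sum>j\<in>Basis. U2 j j x)"
  by (simp add: laplacian_def U2_def U_def[abs_def])

lemma sum_U2: "x \<in> \<Omega> \<Longrightarrow> (\<Sum>j\<in>Basis. U2 j j x) = - f (u x)"
  using equation[of x] by (simp add: laplacian_eq)

text \<open>The equation differentiated along \<open>i\<close>, with the order of derivatives
  exchanged.\<close>

lemma sum_U3:
  assumes x: "x \<in> \<Omega>"
  shows "(\<Sum>j\<in>Basis. U3 i j j x) = - (deriv f (u x) * U i x)"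
proof -
  have "has_pd (\<lambda>x. \<Sum>j\<in>Basis. U2 j j x) i (\<Sum>j\<in>Basis. U3 j j i x) x"
    using has_pd_U2[OF x] unfolding has_pd_def by (intro DERIV_sum)
  moreover have "has_pd (\<lambda>x. f (u x)) i (deriv f (u x) * U i x) x"
    by (rule has_pd_compose[OF f_deriv has_pd_u[OF x]])
  hence "has_pd (\<lambda>x. - f (u x)) i (- (deriv f (u x) * U i x)) x"
    unfolding has_pd_def by (rule DERIV_minus)
  hence "has_pd (\<lambda>x. \<Sum>j\<in>Basis. U2 j j x) i (- (deriv f (u x) * U i x)) x"
    by (rule has_pd_cong_open[OF open_dom x, rotated]) (simp add: sum_U2)
  ultimately have "(\<Sum>j\<in>Basis. U3 j j i x) = - (deriv f (u x) * U i x)" by (rule has_pd_unique)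
  thus ?thesis using U3_commute[OF x] by simp
qed

lemma grad_inner: "b \<in> Basis \<Longrightarrow> grad u x \<bullet> b = U b x"
  by (simp add: grad_inner_Basis U_def)

lemma norm_grad: "(norm (grad u x))\<^sup>2 = (\<Sum>b\<in>Basis. (U b x)\<^sup>2)"
  unfolding sum_Basis_inner_squared[of "grad u x", symmetric] by (simp add: grad_inner)

section \<open>Derivatives of \<open>P\<close> and Bochner's formula\<close>

lemma P_eq: "P x = (\<Sum>b\<in>Basis. (U b x)\<^sup>2) + 2 * F (u x)"
  by (simp add: P_function_def norm_grad)

lemma P_le_norm_grad: "P x \<le> (norm (grad u x))\<^sup>2"
  using F_nonpos[of "u x"] by (simp add: P_function_def)

lemma has_pd_P:
  assumes "x \<in> \<Omega>"
  shows "has_pd P b (P1 b x) x"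
  unfolding has_pd_def P_eq P1_def
  by (rule DERIV_cong, rule DERIV_add[OF DERIV_sum[OF DERIV_power[OF has_pd_U[OF assms, unfolded has_pd_def]]]
      DERIV_cmult[OF has_pd_compose[OF F_deriv has_pd_u[OF assms], unfolded has_pd_def]]])
    (simp add: sum_distrib_left mult_ac)

lemma has_pd_P1:
  assumes x: "x \<in> \<Omega>"
  shows "has_pd (P1 b) b (P2 b x) x"
proof -
  note d = has_pd_U[OF x, unfolded has_pd_def] has_pd_U2[OF x, unfolded has_pd_def]
    has_pd_compose[OF f_deriv has_pd_u[OF x], unfolded has_pd_def]
  show ?thesis unfolding has_pd_def P1_def P2_def
    by (rule DERIV_cong, rule DERIV_add[OF DERIV_cmult[OF DERIV_sum[OF DERIV_mult[OF d(1,2)]]]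
      DERIV_cmult[OF DERIV_mult[OF d(3,1)]]])
      (simp add: power2_eq_square mult_ac)
qed

lemma P_cont: "continuous_on \<Omega> P"
  unfolding P_eq[abs_def] by (intro continuous_intros U_cont continuous_on_compose2[OF F_cont u_cont]) auto

text \<open>By the differentiated equation the third derivatives cancel the \<open>deriv f\<close>
  term of \<open>P2\<close>; the trace of the Hessian is \<open>- f (u x)\<close>.\<close>

lemma sum_P2:
  assumes x: "x \<in> \<Omega>"
  shows "(\<Sum>b\<in>Basis. P2 b x) = 2 * (\<Sum>b\<in>Basis. \<Sum>i\<in>Basis. (U2 i b x)\<^sup>2) - 2 * (f (u x))\<^sup>2"
proof -
  have "(\<Sum>b\<in>Basis. \<Sum>i\<in>Basis. U i x * U3 i b b x) = (\<Sum>i\<in>Basis. \<Sum>b\<in>Basis. U i x * U3 i b b x)"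
    by (rule sum.swap)
  also have "\<dots> = (\<Sum>i\<in>Basis. U i x * (\<Sum>b\<in>Basis. U3 i b b x))"
    by (simp only: sum_distrib_left)
  also have "\<dots> = (\<Sum>i\<in>Basis. - deriv f (u x) * (U i x)\<^sup>2)"
    unfolding sum_U3[OF x] by (intro sum.cong refl) algebra
  also have "\<dots> = - deriv f (u x) * (\<Sum>i\<in>Basis. (U i x)\<^sup>2)"
    by (rule sum_distrib_left[symmetric])
  finally show ?thesis
    using sum_U2[OF x]
    by (simp add: P2_def sum.distrib sum_distrib_left[symmetric] power2_eq_square)
qed

text \<open>Cauchy-Schwarz in each row of the Hessian; it is the only source of inequality in
  \<open>bochner\<close>.\<close>

lemma sum_hessian_grad_squared_le:
  "(\<Sum>b\<in>Basis. (\<Sum>i\<in>Basis. U i x * U2 i b x)\<^sup>2)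
    \<le> (norm (grad u x))\<^sup>2 * (\<Sum>b\<in>Basis. \<Sum>i\<in>Basis. (U2 i b x)\<^sup>2)"
  unfolding norm_grad sum_distrib_left[of _ "\<lambda>b. \<Sum>i\<in>Basis. (U2 i b x)\<^sup>2"]
  by (intro sum_mono Cauchy_Schwarz_ineq_sum)

definition gradP :: "'a \<Rightarrow> 'a" where "gradP x = (\<Sum>b\<in>Basis. P1 b x *\<^sub>R b)"

lemma gradP_inner: "b \<in> Basis \<Longrightarrow> gradP x \<bullet> b = P1 b x"
  by (simp add: gradP_def inner_sum_left inner_Basis if_distrib cong: if_cong)

text \<open>The Hessian applied to the gradient of \<open>u\<close> is half the gradient of
  \<open>P\<close> minus \<open>f (u x)\<close> times the gradient of \<open>u\<close>. Squaring
  this and using Cauchy-Schwarz, the terms with \<open>(f (u x))\<^sup>2\<close> cancel against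
  those of \<open>sum_P2\<close>.\<close>

lemma bochner:
  assumes x: "x \<in> \<Omega>"
  shows "(norm (gradP x))\<^sup>2 / 2 - 2 * f (u x) * (grad u x \<bullet> gradP x)
    \<le> (norm (grad u x))\<^sup>2 * (\<Sum>b\<in>Basis. P2 b x)"
proof -
  define V where "V = (\<lambda>b. \<Sum>i\<in>Basis. U i x * U2 i b x)"
  have V: "V b = P1 b x / 2 - f (u x) * U b x" for b
  proof -
    have "s = (2 * s + 2 * t) / 2 - t" for s t :: real by (simp add: field_simps)
    thus ?thesis unfolding V_def P1_def .
  qed
  have "(V b)\<^sup>2 = 1 / 4 * (P1 b x)\<^sup>2 - f (u x) * (U b x * P1 b x) + (f (u x))\<^sup>2 * (U b x)\<^sup>2" for b
    unfolding V by (simp add: power2_eq_square field_simps)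
  hence "(\<Sum>b\<in>Basis. (V b)\<^sup>2) = 1 / 4 * (\<Sum>b\<in>Basis. (P1 b x)\<^sup>2) - f (u x) * (\<Sum>b\<in>Basis. U b x * P1 b x)
      + (f (u x))\<^sup>2 * (\<Sum>b\<in>Basis. (U b x)\<^sup>2)"
    by (simp only: sum.distrib sum_subtractf sum_distrib_left)
  also have "\<dots> = 1 / 4 * (norm (gradP x))\<^sup>2 - f (u x) * (grad u x \<bullet> gradP x) + (f (u x))\<^sup>2 * (norm (grad u x))\<^sup>2"
    unfolding norm_grad sum_Basis_inner_squared[of "gradP x", symmetric]
      sum_Basis_inner_mult[of "grad u x" "gradP x", symmetric]
    by (simp add: gradP_inner grad_inner)
  finally have "1 / 4 * (norm (gradP x))\<^sup>2 - f (u x) * (grad u x \<bullet> gradP x) + (f (u x))\<^sup>2 * (norm (grad u x))\<^sup>2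
      \<le> (norm (grad u x))\<^sup>2 * (\<Sum>b\<in>Basis. \<Sum>i\<in>Basis. (U2 i b x)\<^sup>2)"
    using sum_hessian_grad_squared_le[of x] by (simp add: V_def)
  thus ?thesis by (simp add: sum_P2[OF x] algebra_simps)
qed

end

text \<open>Assumptions 1 and 2 are the first and second order conditions at an interior maximum of
  \<open>\<eta> P + \<epsilon> exp (\<Lambda> u)\<close>, with \<open>E = \<epsilon> \<Lambda> exp (\<Lambda> u)\<close>, and 3 is the Bochner inequality. The term
  \<open>\<bar>A\<bar>\<^sup>2 / 2\<close> absorbs \<open>e \<bullet> A\<close>, so that no a priori bound on the gradient of \<open>u\<close> is needed.\<close>

lemma cutoff_contradiction:
  fixes g A e :: "'a::real_inner"
  assumes 1: "\<eta> *\<^sub>R A + P *\<^sub>R e + E *\<^sub>R g = 0"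
    and 2: "P * D\<eta> + 2 * (e \<bullet> A) + \<eta> * DP + E * (\<Lambda> * (norm g)\<^sup>2 - f) \<le> 0"
    and 3: "(norm A)\<^sup>2 / 2 - 2 * f * (g \<bullet> A) \<le> (norm g)\<^sup>2 * DP"
    and pos: "0 < \<eta>" "0 < d" "0 < E" "0 < \<Lambda>" "0 \<le> \<theta>"
    and P: "P \<le> (norm g)\<^sup>2" "d\<^sup>2 < P"
    and bd: "\<bar>D\<eta>\<bar> \<le> \<theta>" "(norm e)\<^sup>2 \<le> \<theta> * \<eta>" "norm e \<le> \<theta>" "\<bar>f\<bar> \<le> K" "2 * K \<le> \<Lambda> * d\<^sup>2"
    and large: "\<theta> * (3 + 2 * K / d) < E * \<Lambda> / 2"
  shows False
proof -
  define a where "a = (norm g)\<^sup>2"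
  have a: "d\<^sup>2 < a" "P \<le> a" using P by (auto simp: a_def)
  have a0: "a > 0" using a pos by (smt (verit) zero_le_power2)
  have P0: "P > 0" using P by (smt (verit) zero_le_power2)
  have K0: "K \<ge> 0" using bd(4) by linarith
  have dg: "d \<le> norm g" using a pos by (smt (verit) a_def norm_ge_zero power2_le_imp_le)
  \<comment> \<open>Pairing the first-order condition with \<open>g\<close> expresses
    \<open>g \<bullet> A\<close> in the Bochner inequality through \<open>g \<bullet> e\<close> and
    \<open>E\<close>.\<close>
  have "(\<eta> *\<^sub>R A + P *\<^sub>R e + E *\<^sub>R g) \<bullet> g = 0" using 1 by simp
  hence "\<eta> * (g \<bullet> A) + P * (g \<bullet> e) + E * a = 0"
    unfolding a_def power2_norm_eq_inner inner_add_left inner_scaleR_left inner_commute[of g A] inner_commute[of g e] .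
  hence gA: "\<eta> * (g \<bullet> A) = - P * (g \<bullet> e) - E * a" by linarith
  \<comment> \<open>Young's inequality from a square: the quadratic term in \<open>A\<close> absorbs
    \<open>2 * a * (e \<bullet> A)\<close> at the price of
    \<open>2 * a * a * \<theta>\<close>.\<close>
  have "0 \<le> (\<eta> *\<^sub>R A + (2 * a) *\<^sub>R e) \<bullet> (\<eta> *\<^sub>R A + (2 * a) *\<^sub>R e)" by simp
  also have "\<dots> = \<eta> * (\<eta> * (A \<bullet> A)) + \<eta> * (4 * a * (e \<bullet> A)) + 4 * a * a * (e \<bullet> e)"
    by (simp only: inner_add_left inner_add_right inner_scaleR_left inner_scaleR_right inner_commute[of A e])
      (simp add: algebra_simps del: dot_square_norm)
  also have "\<dots> \<le> \<eta> * (\<eta> * (A \<bullet> A)) + \<eta> * (4 * a * (e \<bullet> A)) + 4 * a * a * (\<theta> * \<eta>)"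
    using bd(2) a0 unfolding power2_norm_eq_inner by (intro add_left_mono mult_left_mono) auto
  also have "\<dots> = (2 * \<eta>) * (\<eta> * (A \<bullet> A) / 2 + 2 * a * (e \<bullet> A) + 2 * a * a * \<theta>)"
    by (simp add: algebra_simps del: dot_square_norm)
  finally have young: "0 \<le> \<eta> * ((norm A)\<^sup>2 / 2) + 2 * a * (e \<bullet> A) + 2 * a * a * \<theta>"
    using pos by (simp add: zero_le_mult_iff power2_norm_eq_inner)
  have t1: "- (a * a * \<theta>) \<le> a * (P * D\<eta>)"
  proof -
    have "P * \<bar>D\<eta>\<bar> \<le> a * \<theta>" using bd a P0 by (intro mult_mono) auto
    hence "- (a * \<theta>) \<le> P * D\<eta>" using P0 by (smt (verit) abs_mult abs_of_pos abs_le_iff)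
    hence "a * (- (a * \<theta>)) \<le> a * (P * D\<eta>)" using a0 by (intro mult_left_mono) auto
    thus ?thesis by (simp add: mult.assoc)
  qed
  have t2: "- (2 * K * \<theta> / d * a * a) \<le> 2 * f * P * (g \<bullet> e)"
  proof -
    have "norm g * d \<le> a" using dg by (simp add: a_def power2_eq_square mult_left_mono)
    hence ng: "norm g \<le> a / d" using pos by (simp add: pos_le_divide_eq)
    have "\<bar>f * P * (g \<bullet> e)\<bar> = \<bar>f\<bar> * P * \<bar>g \<bullet> e\<bar>" using P0 by (simp add: abs_mult)
    also have "\<dots> \<le> K * a * (norm g * norm e)"
      using bd a P0 K0 by (intro mult_mono Cauchy_Schwarz_ineq2) auto
    also have "\<dots> \<le> K * a * (a / d * \<theta>)"
      using ng bd K0 a0 pos by (intro mult_left_mono mult_mono) auto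
    finally have "\<bar>f * P * (g \<bullet> e)\<bar> \<le> K * \<theta> / d * a * a" by (simp add: mult_ac)
    thus ?thesis by (simp add: abs_le_iff mult.assoc)
  qed
  \<comment> \<open>As \<open>\<Lambda> * a\<close> exceeds \<open>2 * K\<close>, half of it absorbs
    \<open>f\<close>.\<close>
  have t3: "E * \<Lambda> / 2 * a * a \<le> E * a * (\<Lambda> * a + f)"
  proof -
    have "\<Lambda> * d\<^sup>2 \<le> \<Lambda> * a" using a pos by simp
    hence "\<Lambda> * a / 2 \<le> \<Lambda> * a + f" using bd by linarith
    hence "E * a * (\<Lambda> * a / 2) \<le> E * a * (\<Lambda> * a + f)" using pos a0 by (intro mult_left_mono) auto
    thus ?thesis by (simp add: mult_ac)
  qed
  \<comment> \<open>The second-order condition is multiplied by \<open>a\<close> so that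
    \<open>a * DP\<close> can be replaced by the Bochner bound. Substituting for
    \<open>g \<bullet> A\<close> then turns \<open>- f\<close> into \<open>+ f\<close> in the last
    term.\<close>
  have "a * (P * D\<eta> + 2 * (e \<bullet> A) + \<eta> * DP + E * (\<Lambda> * a - f)) \<le> 0"
    using 2 a0 by (simp add: a_def mult_le_0_iff)
  hence "a * (P * D\<eta>) + 2 * a * (e \<bullet> A) + \<eta> * (a * DP) + E * a * (\<Lambda> * a - f) \<le> 0"
    by (simp add: algebra_simps)
  moreover have "\<eta> * ((norm A)\<^sup>2 / 2 - 2 * f * (g \<bullet> A)) \<le> \<eta> * (a * DP)"
    using 3 pos by (intro mult_left_mono) (auto simp: a_def)
  moreover have "\<eta> * ((norm A)\<^sup>2 / 2 - 2 * f * (g \<bullet> A))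
      = \<eta> * ((norm A)\<^sup>2 / 2) + 2 * f * P * (g \<bullet> e) + 2 * f * E * a"
    using arg_cong[OF gA, of "\<lambda>t. 2 * f * t"] by (simp add: algebra_simps)
  ultimately have "a * (P * D\<eta>) + 2 * a * (e \<bullet> A) + \<eta> * ((norm A)\<^sup>2 / 2) + 2 * f * P * (g \<bullet> e)
      + 2 * f * E * a + E * a * (\<Lambda> * a - f) \<le> 0" by linarith
  hence "a * (P * D\<eta>) + (2 * a * (e \<bullet> A) + \<eta> * ((norm A)\<^sup>2 / 2)) + 2 * f * P * (g \<bullet> e)
      + E * a * (\<Lambda> * a + f) \<le> 0" by (simp add: algebra_simps)
  hence "E * \<Lambda> / 2 * a * a - 3 * (a * a * \<theta>) - 2 * K * \<theta> / d * a * a \<le> 0"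
    using young t1 t2 t3 by linarith
  hence "(E * \<Lambda> / 2 - \<theta> * (3 + 2 * K / d)) * (a * a) \<le> 0" by (simp add: algebra_simps)
  moreover have "0 < (E * \<Lambda> / 2 - \<theta> * (3 + 2 * K / d)) * (a * a)"
    using large a0 by (intro mult_pos_pos) auto
  ultimately show False by linarith
qed

section \<open>The bound for \<open>P\<close>\<close>

text \<open>Squaring \<open>q\<close> makes the squared gradient of the cutoff at most a multiple of
  the cutoff itself inside the ball, as \<open>cutoff_contradiction\<close> requires.\<close>

lemma has_pd_cutoff:
  fixes c :: "'a::real_inner" and k :: real
  defines "q \<equiv> \<lambda>z. 1 - k * (norm (z - c))\<^sup>2"
  shows "has_pd (\<lambda>z. (q z)\<^sup>2) b (- 4 * k * q x * ((x - c) \<bullet> b)) x"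
    and "norm b = 1 \<Longrightarrow> has_pd (\<lambda>z. - 4 * k * q z * ((z - c) \<bullet> b)) b
      (8 * k\<^sup>2 * ((x - c) \<bullet> b)\<^sup>2 - 4 * k * q x) x"
proof -
  have q: "((\<lambda>t. q (x + t *\<^sub>R b)) has_real_derivative - (k * (2 * ((x - c) \<bullet> b)))) (at 0)"
    unfolding q_def using DERIV_diff[OF DERIV_const DERIV_cmult[OF has_pd_dist_squared[of c b x, unfolded has_pd_def]]]
    by simp
  show "has_pd (\<lambda>z. (q z)\<^sup>2) b (- 4 * k * q x * ((x - c) \<bullet> b)) x"
    unfolding has_pd_def by (rule DERIV_cong, rule DERIV_power[OF q]) simp
  assume "norm b = 1"
  hence "b \<bullet> b = 1" by (simp add: norm_eq_1)
  hence l: "((\<lambda>t. (x + t *\<^sub>R b - c) \<bullet> b) has_real_derivative 1) (at 0)"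
    by (auto simp: inner_simps intro!: derivative_eq_intros)
  show "has_pd (\<lambda>z. - 4 * k * q z * ((z - c) \<bullet> b)) b (8 * k\<^sup>2 * ((x - c) \<bullet> b)\<^sup>2 - 4 * k * q x) x"
    unfolding has_pd_def
    by (rule DERIV_cong, rule DERIV_mult[OF DERIV_cmult[OF q] l]) (simp add: algebra_simps power2_eq_square)
qed

text \<open>The derivatives of the cutoff are of order \<open>1 / R\<close>, so once
  \<open>R\<close> satisfies \<open>large\<close> the first and second order conditions at
  \<open>y\<close> meet the assumptions of \<open>cutoff_contradiction\<close>.\<close>

lemma (in semilinear_equation) no_interior_maximum:
  fixes c :: 'a and R \<epsilon> \<Lambda> d K :: real
  defines "k \<equiv> 1 / R\<^sup>2"
  defines "q \<equiv> \<lambda>z. 1 - k * (norm (z - c))\<^sup>2"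
  assumes y: "y \<in> \<Omega>" "norm (y - c) < R"
    and max: "\<And>z. z \<in> \<Omega> \<Longrightarrow> norm (z - c) < R \<Longrightarrow>
      (q z)\<^sup>2 * P z + \<epsilon> * exp (\<Lambda> * u z) \<le> (q y)\<^sup>2 * P y + \<epsilon> * exp (\<Lambda> * u y)"
    and pos: "0 < d" "0 < \<epsilon>" "0 < \<Lambda>" "1 \<le> R" "0 \<le> u y"
    and Py: "d\<^sup>2 < P y" and K: "\<bar>f (u y)\<bar> \<le> K" "2 * K \<le> \<Lambda> * d\<^sup>2"
    and large: "(16 + 4 * real DIM('a)) / R * (3 + 2 * K / d) < \<epsilon> * \<Lambda> * \<Lambda> / 2"
  shows False
proof -
  define n where "n = real DIM('a)"
  \<comment> \<open>One bound for the gradient of the cutoff, its Laplacian, and its squared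
    gradient relative to the cutoff.\<close>
  define \<theta> where "\<theta> = (16 + 4 * n) / R"
  define E where "E = (\<lambda>z. \<epsilon> * \<Lambda> * exp (\<Lambda> * u z))"
  define S where "S = \<Omega> \<inter> ball c R"
  have S: "open S" "y \<in> S" using open_dom y by (auto simp: S_def dist_norm norm_minus_commute)
  have S\<Omega>: "z \<in> \<Omega>" "norm (z - c) < R" if "z \<in> S" for z
    using that by (auto simp: S_def dist_norm norm_minus_commute)
  define e1 where "e1 = (\<lambda>b z. - 4 * k * q z * ((z - c) \<bullet> b))"
  define e2 where "e2 = (\<lambda>b z. 8 * k\<^sup>2 * ((z - c) \<bullet> b)\<^sup>2 - 4 * k * q z)"
  define w1 where "w1 = (\<lambda>b z. (e1 b z * P z + P1 b z * (q z)\<^sup>2) + E z * U b z)"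
  define w2 where "w2 = (\<lambda>b z. (e2 b z * P z + 2 * (e1 b z * P1 b z) + (q z)\<^sup>2 * P2 b z)
    + E z * (\<Lambda> * (U b z)\<^sup>2 + U2 b b z))"
  have exp_pd: "has_pd (\<lambda>z. exp (\<Lambda> * u z)) b (\<Lambda> * exp (\<Lambda> * u z) * U b z) z" if "z \<in> \<Omega>" for z b
  proof (rule has_pd_compose[of "\<lambda>s. exp (\<Lambda> * s)", OF _ has_pd_u[OF that]])
    show "((\<lambda>s. exp (\<Lambda> * s)) has_real_derivative \<Lambda> * exp (\<Lambda> * u z)) (at (u z))"
      by (auto intro!: derivative_eq_intros)
  qed
  note pd = has_pd_def
  have w1: "has_pd (\<lambda>z. (q z)\<^sup>2 * P z + \<epsilon> * exp (\<Lambda> * u z)) b (w1 b z) z" if "z \<in> S" "b \<in> Basis" for z b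
    using DERIV_add[OF DERIV_mult[OF has_pd_cutoff(1)[where c = c and k = k and b = b and x = z, unfolded pd]
      has_pd_P[OF S\<Omega>(1)[OF that(1)], where b = b, unfolded pd]] DERIV_cmult[OF exp_pd[OF S\<Omega>(1)[OF that(1)], where b = b, unfolded pd]], of \<epsilon>]
    unfolding w1_def e1_def q_def E_def pd by (simp add: mult_ac)
  have w2: "has_pd (w1 b) b (w2 b y) y" if b: "b \<in> Basis" for b
  proof -
    have 1: "has_pd (e1 b) b (e2 b y) y"
      unfolding e1_def e2_def q_def by (rule has_pd_cutoff(2)) (use b in simp)
    have 2: "has_pd (\<lambda>z. (q z)\<^sup>2) b (e1 b y) y" unfolding e1_def q_def by (rule has_pd_cutoff(1))
    have 3: "has_pd E b (\<Lambda> * E y * U b y) y"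
      using DERIV_cmult[OF exp_pd[OF y(1), where b = b, unfolded pd], of "\<epsilon> * \<Lambda>"]
      unfolding E_def pd by (simp add: mult_ac)
    note ds = 1[unfolded pd] 2[unfolded pd] 3[unfolded pd] has_pd_P[OF y(1), of b, unfolded pd]
      has_pd_P1[OF y(1), of b, unfolded pd] has_pd_U[OF y(1), of b b, unfolded pd]
    show ?thesis unfolding w1_def w2_def pd
      by (rule DERIV_cong, rule DERIV_add[OF DERIV_add[OF DERIV_mult[OF ds(1,4)] DERIV_mult[OF ds(5,2)]]
        DERIV_mult[OF ds(3,6)]]) (simp add: algebra_simps power2_eq_square)
  qed
  have crit: "w1 b y = 0" "w2 b y \<le> 0" if b: "b \<in> Basis" for b
    using local_max_pd[of S y "\<lambda>z. (q z)\<^sup>2 * P z + \<epsilon> * exp (\<Lambda> * u z)" b "w1 b", OF S _ w1[OF _ b] w2[OF b]] max S\<Omega>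
    by blast+
  define e where "e = (- 4 * k * q y) *\<^sub>R (y - c)"
  have e: "e \<bullet> b = e1 b y" for b by (simp add: e_def e1_def)
  have E0: "E y > 0" using pos by (simp add: E_def)
  have R0: "R > 0" using pos by simp
  have k0: "k > 0" using R0 by (simp add: k_def)
  have n0: "n \<ge> 0" by (simp add: n_def)
  have ny: "k * (norm (y - c))\<^sup>2 < 1"
    using power_strict_mono[OF y(2), of 2] R0 by (simp add: k_def)
  have q01: "0 < q y" "q y \<le> 1" using ny k0 by (auto simp: q_def)
  \<comment> \<open>Here \<open>1 \<le> R\<close> turns the natural order
    \<open>1 / R\<^sup>2\<close> into the \<open>1 / R\<close> of \<theta>.\<close>
  have kR: "k \<le> 1 / R" using pos by (simp add: k_def power2_eq_square divide_simps)
  have kR2: "16 * k \<le> \<theta>\<^sup>2"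
  proof -
    have "16 * k = 16 / R\<^sup>2" by (simp add: k_def)
    also have "\<dots> \<le> (16 + 4 * n)\<^sup>2 / R\<^sup>2"
    proof (rule divide_right_mono)
      have "(16::real) \<le> 16\<^sup>2" by simp
      also have "\<dots> \<le> (16 + 4 * n)\<^sup>2" using n0 by (intro power_mono) auto
      finally show "16 \<le> (16 + 4 * n)\<^sup>2" .
    qed simp
    finally show ?thesis by (simp add: \<theta>_def power_divide)
  qed
  have \<theta>0: "0 \<le> \<theta>" using n0 R0 by (simp add: \<theta>_def)
  have "(16 + 4 * n) * k \<le> \<theta>"
    using mult_left_mono[OF kR, of "16 + 4 * n"] n0 by (simp add: \<theta>_def)
  moreover have nk: "0 \<le> k * n" using n0 k0 by simp
  ultimately have kth: "16 * k + 4 * (k * n) \<le> \<theta>" by (simp add: algebra_simps)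
  have ne: "(norm e)\<^sup>2 = 16 * k * (q y)\<^sup>2 * (k * (norm (y - c))\<^sup>2)"
    by (simp add: e_def power_mult_distrib) (simp add: power2_eq_square)
  have ne1: "(norm e)\<^sup>2 \<le> 16 * k * (q y)\<^sup>2"
    unfolding ne using ny k0 by (intro mult_left_le) auto
  have "(norm e)\<^sup>2 \<le> \<theta> * (q y)\<^sup>2"
  proof -
    have "16 * k \<le> \<theta>" using kth nk by linarith
    hence "16 * k * (q y)\<^sup>2 \<le> \<theta> * (q y)\<^sup>2" by (intro mult_right_mono) auto
    thus ?thesis using ne1 by linarith
  qed
  moreover have "norm e \<le> \<theta>"
  proof -
    have "(q y)\<^sup>2 \<le> 1" using q01 by (simp add: power_le_one)
    hence "16 * k * (q y)\<^sup>2 \<le> 16 * k" using k0 by (intro mult_left_le) auto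
    hence "(norm e)\<^sup>2 \<le> \<theta>\<^sup>2" using ne1 kR2 by linarith
    thus ?thesis using \<theta>0 by (rule power2_le_imp_le)
  qed
  moreover have "\<bar>\<Sum>b\<in>Basis. e2 b y\<bar> \<le> \<theta>"
  proof -
    have "(\<Sum>b\<in>Basis. e2 b y) = 8 * k * (k * (norm (y - c))\<^sup>2) - 4 * k * n * q y"
    proof -
      have "(\<Sum>b\<in>Basis. e2 b y) = 8 * k\<^sup>2 * (norm (y - c))\<^sup>2 - 4 * k * n * q y"
        by (simp add: e2_def sum_subtractf sum_distrib_left[symmetric] sum_Basis_inner_squared n_def)
      thus ?thesis by (simp add: power2_eq_square mult_ac)
    qed
    moreover have "0 \<le> 8 * k * (k * (norm (y - c))\<^sup>2)" "8 * k * (k * (norm (y - c))\<^sup>2) \<le> 8 * k"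
      using ny k0 by (auto intro!: mult_left_le)
    moreover have "0 \<le> 4 * k * n * q y" "4 * k * n * q y \<le> 4 * k * n"
      using q01 k0 n0 by (auto intro!: mult_left_le)
    moreover have "8 * k \<le> \<theta>" "4 * k * n \<le> \<theta>"
      using kth nk k0 unfolding mult.assoc by linarith+
    ultimately show ?thesis by linarith
  qed
  moreover have "(q y)\<^sup>2 *\<^sub>R gradP y + P y *\<^sub>R e + E y *\<^sub>R grad u y = 0"
  proof (rule euclidean_eqI)
    fix b :: 'a assume b: "b \<in> Basis"
    show "((q y)\<^sup>2 *\<^sub>R gradP y + P y *\<^sub>R e + E y *\<^sub>R grad u y) \<bullet> b = 0 \<bullet> b"
      using crit(1)[OF b] by (simp add: inner_add_left gradP_inner[OF b] grad_inner[OF b] e w1_def algebra_simps)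
  qed
  moreover have "P y * (\<Sum>b\<in>Basis. e2 b y) + 2 * (e \<bullet> gradP y) + (q y)\<^sup>2 * (\<Sum>b\<in>Basis. P2 b y)
      + E y * (\<Lambda> * (norm (grad u y))\<^sup>2 - f (u y)) \<le> 0"
  proof -
    have "(\<Sum>b\<in>Basis. w2 b y) \<le> 0" using crit(2) by (rule sum_nonpos)
    moreover have "(\<Sum>b\<in>Basis. w2 b y) = P y * (\<Sum>b\<in>Basis. e2 b y) + 2 * (\<Sum>b\<in>Basis. (e \<bullet> b) * (gradP y \<bullet> b))
      + (q y)\<^sup>2 * (\<Sum>b\<in>Basis. P2 b y) + E y * (\<Lambda> * (\<Sum>b\<in>Basis. (U b y)\<^sup>2) + (\<Sum>b\<in>Basis. U2 b b y))"
      by (simp add: w2_def sum.distrib e gradP_inner sum_distrib_left distrib_left mult.commute[of "P y"])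
    ultimately show ?thesis by (simp add: sum_Basis_inner_mult norm_grad sum_U2[OF y(1)])
  qed
  moreover have "\<theta> * (3 + 2 * K / d) < E y * \<Lambda> / 2"
  proof -
    \<comment> \<open>The exponential is at least 1 because \<open>0 \<le> u y\<close>; thus
      \<open>large\<close> can be stated without reference to \<open>y\<close>.\<close>
    have "\<epsilon> * \<Lambda> * 1 \<le> E y" unfolding E_def using pos by (intro mult_left_mono) auto
    hence "\<epsilon> * \<Lambda> * \<Lambda> / 2 \<le> E y * \<Lambda> / 2" using pos by simp
    thus ?thesis using large by (simp add: \<theta>_def n_def)
  qed
  moreover have "0 < (q y)\<^sup>2" using q01 by simp
  ultimately show False
    using cutoff_contradiction[of "(q y)\<^sup>2" "gradP y" "P y" e "E y" "grad u y" "\<Sum>b\<in>Basis. e2 b y"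
      "\<Sum>b\<in>Basis. P2 b y" \<Lambda> "f (u y)" d \<theta> K]
      bochner[OF y(1)] pos E0 \<theta>0 P_le_norm_grad[of y] Py K by blast
qed

text \<open>The cutoff expression is maximized over the closure of \<Omega> in a ball, with
  \<open>G\<close> continuing the gradient. Too large a value of \<open>P\<close> at the centre
  \<open>x0\<close> keeps the maximum off the frontier, by the boundary bound, and off the sphere,
  where the cutoff vanishes; \<open>no_interior_maximum\<close> excludes the rest.\<close>

lemma (in semilinear_equation) P_estimate:
  assumes G: "continuous_on (closure \<Omega>) G" "\<And>x. x \<in> \<Omega> \<Longrightarrow> G x = grad u x"
    and u: "continuous_on (closure \<Omega>) u" "\<And>x. x \<in> \<Omega> \<Longrightarrow> 0 < u x" "\<And>x. x \<in> \<Omega> \<Longrightarrow> u x \<le> M"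
    and bdry: "\<And>x. x \<in> frontier \<Omega> \<Longrightarrow> u x = 0" "\<And>x. x \<in> frontier \<Omega> \<Longrightarrow> (norm (G x))\<^sup>2 \<le> k"
    and x0: "x0 \<in> \<Omega>"
  shows "P x0 \<le> max 0 (k + 2 * F 0)"
proof (rule field_le_epsilon)
  fix e :: real assume e: "e > 0"
  define m where "m = max 0 (k + 2 * F 0)"
  have m: "0 \<le> m" by (simp add: m_def)
  have M: "M > 0" using u(2,3)[OF x0] by linarith
  have u': "0 \<le> u x" "u x \<le> M" if "x \<in> closure \<Omega>" for x
    using that u(2,3)[of x] bdry(1)[of x] M by (fastforce simp: closure_Un_frontier)+
  have "compact (f ` {0..M})"
    using f_cont by (intro compact_continuous_image) (auto intro: continuous_on_subset)
  then obtain K where K: "\<And>s. s \<in> {0..M} \<Longrightarrow> \<bar>f s\<bar> \<le> K"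
    using compact_imp_bounded[of "f ` {0..M}"] unfolding bounded_iff real_norm_def by blast
  have K0: "K \<ge> 0" using K[of 0] M by auto
  \<comment> \<open>At the maximum \<open>P\<close> will exceed \<open>m + e / 2\<close>, hence
    \<open>d\<^sup>2\<close>.\<close>
  define d where "d = sqrt (e / 2)"
  have d: "d > 0" "d\<^sup>2 = e / 2" using e by (auto simp: d_def)
  define \<Lambda> where "\<Lambda> = 2 * K / d\<^sup>2 + 1"
  have \<Lambda>: "\<Lambda> > 0" "2 * K \<le> \<Lambda> * d\<^sup>2" using K0 d by (auto simp: \<Lambda>_def add_nonneg_pos field_simps)
  \<comment> \<open>Since \<open>u\<close> is at most \<open>M\<close>, the exponential term is then
    at most \<open>e / 2\<close>.\<close>
  define \<epsilon> where "\<epsilon> = e / 2 * exp (- (\<Lambda> * M))"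
  have \<epsilon>: "\<epsilon> > 0" using e by (simp add: \<epsilon>_def)
  define C where "C = (16 + 4 * real DIM('a)) * (3 + 2 * K / d)"
  have C: "C \<ge> 0" using K0 d by (simp add: C_def)
  \<comment> \<open>\<Lambda> and \<epsilon> are fixed by now, so the radius can be chosen to
    satisfy \<open>large\<close>.\<close>
  define R where "R = 1 + 2 * C / (\<epsilon> * \<Lambda> * \<Lambda>)"
  have R: "R \<ge> 1" using C \<epsilon> \<Lambda> by (simp add: R_def)
  have "C < R * (\<epsilon> * \<Lambda> * \<Lambda> / 2)" using \<epsilon> \<Lambda> by (simp add: R_def field_simps)
  hence "C / R < \<epsilon> * \<Lambda> * \<Lambda> / 2" using R by (simp add: divide_less_eq mult.commute)
  hence large: "(16 + 4 * real DIM('a)) / R * (3 + 2 * K / d) < \<epsilon> * \<Lambda> * \<Lambda> / 2" by (simp add: C_def)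
  define q where "q = (\<lambda>z. 1 - 1 / R\<^sup>2 * (norm (z - x0))\<^sup>2)"
  define w where "w = (\<lambda>z. (q z)\<^sup>2 * ((norm (G z))\<^sup>2 + 2 * F (u z)) + \<epsilon> * exp (\<Lambda> * u z))"
  have wP: "w z = (q z)\<^sup>2 * P z + \<epsilon> * exp (\<Lambda> * u z)" if "z \<in> \<Omega>" for z
    using G(2)[OF that] by (simp add: w_def P_function_def)
  define T where "T = closure \<Omega> \<inter> cball x0 R"
  have "compact T" unfolding T_def by (intro closed_Int_compact) auto
  moreover have "x0 \<in> T" using x0 R closure_subset by (auto simp: T_def)
  moreover have "continuous_on T w"
    unfolding w_def q_def
    by (intro continuous_intros continuous_on_compose2[OF F_cont] continuous_on_subset[OF G(1)] continuous_on_subset[OF u(1)])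
      (auto simp: T_def)
  ultimately obtain y where y: "y \<in> T" "\<And>z. z \<in> T \<Longrightarrow> w z \<le> w y"
    using continuous_attains_sup[of T w] by blast
  have yc: "y \<in> closure \<Omega>" "norm (y - x0) \<le> R" using y(1) by (auto simp: T_def dist_norm norm_minus_commute)
  show "P x0 \<le> max 0 (k + 2 * F 0) + e"
  proof (rule ccontr)
    assume "\<not> ?thesis"
    hence "m + e < P x0" by (simp add: m_def)
    also have "P x0 \<le> w x0" using wP[OF x0] \<epsilon> by (simp add: q_def)
    also have "w x0 \<le> w y" by (rule y) fact
    also have "w y \<le> (q y)\<^sup>2 * ((norm (G y))\<^sup>2 + 2 * F (u y)) + e / 2"
    proof -
      have "exp (\<Lambda> * u y) \<le> exp (\<Lambda> * M)" using u'[OF yc(1)] \<Lambda> by simp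
      hence "\<epsilon> * exp (\<Lambda> * u y) \<le> \<epsilon> * exp (\<Lambda> * M)" using \<epsilon> by simp
      also have "\<dots> = e / 2" by (simp add: \<epsilon>_def mult_exp_exp)
      finally show ?thesis by (simp add: w_def)
    qed
    finally have big: "m + e / 2 < (q y)\<^sup>2 * ((norm (G y))\<^sup>2 + 2 * F (u y))" by simp
    have "(norm (y - x0))\<^sup>2 \<le> R\<^sup>2" using yc by (intro power_mono) auto
    hence q01: "0 \<le> q y" "q y \<le> 1" using R by (auto simp: q_def)
    have q21: "0 \<le> (q y)\<^sup>2" "(q y)\<^sup>2 \<le> 1" using q01 by (auto simp: power_le_one)
    \<comment> \<open>A positive product with a factor in \<open>[0, 1]\<close> does not decrease
      when that factor is dropped.\<close>
    have Py: "m + e / 2 < (norm (G y))\<^sup>2 + 2 * F (u y)"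
    proof -
      have "0 < (q y)\<^sup>2 * ((norm (G y))\<^sup>2 + 2 * F (u y))" using big m e by linarith
      hence "0 < (norm (G y))\<^sup>2 + 2 * F (u y)" using q21 by (simp add: zero_less_mult_iff)
      hence "(q y)\<^sup>2 * ((norm (G y))\<^sup>2 + 2 * F (u y)) \<le> (norm (G y))\<^sup>2 + 2 * F (u y)"
        using q21 mult_right_mono[of "(q y)\<^sup>2" 1] by fastforce
      thus ?thesis using big by linarith
    qed
    have "y \<notin> frontier \<Omega>"
    proof
      assume "y \<in> frontier \<Omega>"
      hence "(norm (G y))\<^sup>2 + 2 * F (u y) \<le> m" using bdry[of y] by (simp add: m_def)
      thus False using Py e by linarith
    qed
    hence y\<Omega>: "y \<in> \<Omega>" using yc by (auto simp: closure_Un_frontier)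
    have "norm (y - x0) \<noteq> R"
    proof
      assume "norm (y - x0) = R"
      hence "q y = 0" using R by (simp add: q_def)
      thus False using big m e by simp
    qed
    hence yR: "norm (y - x0) < R" using yc by simp
    have P: "d\<^sup>2 < P y" using Py m d G(2)[OF y\<Omega>] by (simp add: P_function_def)
    show False
    proof (rule no_interior_maximum[OF y\<Omega> yR _ d(1) \<epsilon> \<Lambda>(1) R _ P _ \<Lambda>(2) large])
      show "0 \<le> u y" using u' yc by auto
      show "\<bar>f (u y)\<bar> \<le> K" using u' yc by (intro K) auto
    next
      fix z assume z: "z \<in> \<Omega>" "norm (z - x0) < R"
      have "z \<in> T" using z closure_subset by (auto simp: T_def dist_norm norm_minus_commute)
      thus "(1 - 1 / R\<^sup>2 * (norm (z - x0))\<^sup>2)\<^sup>2 * P z + \<epsilon> * exp (\<Lambda> * u z)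
        \<le> (1 - 1 / R\<^sup>2 * (norm (y - x0))\<^sup>2)\<^sup>2 * P y + \<epsilon> * exp (\<Lambda> * u y)"
        using y(2)[of z] wP[OF z(1)] wP[OF y\<Omega>] by (simp add: q_def)
    qed
  qed
qed

section \<open>Boundary behaviour\<close>

lemma smooth_on_differentiable: "smooth_on \<phi> S \<Longrightarrow> x \<in> S \<Longrightarrow> \<phi> differentiable (at x)"
  unfolding smooth_on_def using Ck_on_SucD(1) by blast

lemma frontier_open_islimpt:
  assumes "open S" "p \<in> frontier S"
  shows "p \<notin> S" "p islimpt S"
  using assms by (auto simp: frontier_def closure_def interior_open)

text \<open>At \<open>p\<close>, a limit point of \<Omega> outside \<Omega>, the function \<phi>
  vanishes; its negative derivative along \<open>v\<close> makes it negative just beyond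
  \<open>p\<close>.\<close>

lemma inward_segment:
  fixes \<Omega> :: "'a::euclidean_space set"
  assumes "open \<Omega>" and p: "p \<in> frontier \<Omega>" and df: "defining_function \<Omega> p U \<phi>"
    and v: "grad \<phi> p \<bullet> v < 0"
  obtains t0 where "t0 > 0" "\<And>t. 0 < t \<Longrightarrow> t < t0 \<Longrightarrow> p + t *\<^sub>R v \<in> \<Omega>"
proof -
  have U: "open U" "p \<in> U" and \<phi>: "smooth_on \<phi> U" and eq: "\<Omega> \<inter> U = {x \<in> U. \<phi> x < 0}"
    using df by (auto simp: defining_function_def)
  note diff = smooth_on_differentiable[OF \<phi> U(2)]
  have "\<phi> p \<ge> 0" using frontier_open_islimpt(1)[OF assms(1) p] U(2) eq by force
  have "\<phi> p \<le> 0"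
  proof (rule ccontr)
    assume "\<not> \<phi> p \<le> 0"
    have "continuous_on U \<phi>" using \<phi> unfolding smooth_on_def by (metis Ck_on.simps(1))
    hence 1: "open (U \<inter> \<phi> -` {0<..})" using U(1) by (intro continuous_open_preimage) auto
    have 2: "p \<in> U \<inter> \<phi> -` {0<..}" using \<open>\<not> \<phi> p \<le> 0\<close> U(2) by auto
    obtain y where "y \<in> \<Omega>" "y \<in> U \<inter> \<phi> -` {0<..}"
      using islimptE[OF frontier_open_islimpt(2)[OF assms(1) p] 2 1] by metis
    moreover from this have "y \<in> {x \<in> U. \<phi> x < 0}" using eq by blast
    ultimately show False by simp
  qed
  hence \<phi>0: "\<phi> p = 0" using \<open>\<phi> p \<ge> 0\<close> by simp
  obtain d where d: "d > 0" "\<And>h. h > 0 \<Longrightarrow> h < d \<Longrightarrow> \<phi> (p + h *\<^sub>R v) < 0"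
    using DERIV_neg_dec_right[OF has_pd_inner_grad[OF diff, unfolded has_pd_def] v] \<phi>0 by auto
  obtain e where e: "e > 0" "\<And>t. \<bar>t\<bar> < e \<Longrightarrow> p + t *\<^sub>R v \<in> U" using open_line_in[OF U] by metis
  show thesis
  proof (rule that[of "min d e"])
    fix t assume "0 < t" "t < min d e"
    hence "p + t *\<^sub>R v \<in> {x \<in> U. \<phi> x < 0}" using d(2)[of t] e(2)[of t] by auto
    thus "p + t *\<^sub>R v \<in> \<Omega>" using eq by blast
  qed (use d e in auto)
qed

text \<open>The direction \<open>- grad \<phi> p\<close>, rescaled to unit parameter length,
  provides a path on which Gronwall's inequality can start at the boundary.\<close>

lemma regular_domain_inward:
  assumes "regular_domain \<Omega>" "p \<in> frontier \<Omega>"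
  obtains v where "\<And>t. 0 < t \<Longrightarrow> t \<le> 1 \<Longrightarrow> p + t *\<^sub>R v \<in> \<Omega>"
proof -
  obtain U \<phi> where df: "defining_function \<Omega> p U \<phi>" using assms unfolding regular_domain_def by blast
  hence "grad \<phi> p \<bullet> (- grad \<phi> p) < 0" by (auto simp: defining_function_def)
  then obtain t0 where t0: "t0 > 0" "\<And>t. 0 < t \<Longrightarrow> t < t0 \<Longrightarrow> p + t *\<^sub>R (- grad \<phi> p) \<in> \<Omega>"
    using inward_segment[OF _ assms(2) df] assms(1) unfolding regular_domain_def by metis
  show thesis
  proof (rule that[of "(t0 / 2) *\<^sub>R (- grad \<phi> p)"])
    fix t :: real assume t: "0 < t" "t \<le> 1"
    hence "t * (t0 / 2) < t0" using t0(1) mult_right_mono[of t 1 "t0 / 2"] by simp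
    thus "p + t *\<^sub>R (t0 / 2) *\<^sub>R (- grad \<phi> p) \<in> \<Omega>" using t0(2)[of "t * (t0 / 2)"] t0(1) t by simp
  qed
qed

text \<open>A positive function vanishing at \<open>p\<close> cannot decrease along any direction entering the domain,
  so its gradient there has no tangential part.\<close>

lemma boundary_gradient_norm:
  fixes \<Omega> :: "'a::euclidean_space set"
  assumes "open \<Omega>" and p: "p \<in> frontier \<Omega>" and u: "continuous_on (closure \<Omega>) u"
    and diff: "\<And>x. x \<in> \<Omega> \<Longrightarrow> u differentiable (at x)"
    and G: "continuous_on (closure \<Omega>) G" "\<And>x. x \<in> \<Omega> \<Longrightarrow> G x = grad u x"
    and pos: "\<And>x. x \<in> \<Omega> \<Longrightarrow> u x > 0" and "u p = 0"
    and nd: "has_normal_derivative \<Omega> u p c"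
  shows "(norm (G p))\<^sup>2 = c\<^sup>2"
proof -
  obtain U \<phi> where df: "defining_function \<Omega> p U \<phi>"
      and lim: "((\<lambda>x. grad u x \<bullet> (grad \<phi> p /\<^sub>R norm (grad \<phi> p))) \<longlongrightarrow> c) (at p within \<Omega>)"
    using nd by (auto simp: has_normal_derivative_def outward_unit_normal_def)
  define \<nu> where "\<nu> = grad \<phi> p /\<^sub>R norm (grad \<phi> p)"
  have g0: "grad \<phi> p \<noteq> 0" using df by (auto simp: defining_function_def)
  have n\<nu>: "norm \<nu> = 1" using g0 by (simp add: \<nu>_def)
  hence \<nu>\<nu>: "\<nu> \<bullet> \<nu> = 1" by (simp add: norm_eq_1)
  have pc: "p \<in> closure \<Omega>" using p by (simp add: frontier_def)
  have Gp: "(G \<longlongrightarrow> G p) (at p within \<Omega>)"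
    using G(1) pc closure_subset[of \<Omega>] by (meson continuous_on_def tendsto_within_subset)
  have "((\<lambda>x. grad u x \<bullet> \<nu>) \<longlongrightarrow> G p \<bullet> \<nu>) (at p within \<Omega>)"
  proof (rule Lim_transform_eventually)
    show "((\<lambda>x. G x \<bullet> \<nu>) \<longlongrightarrow> G p \<bullet> \<nu>) (at p within \<Omega>)" by (intro tendsto_intros Gp)
    show "\<forall>\<^sub>F x in at p within \<Omega>. G x \<bullet> \<nu> = grad u x \<bullet> \<nu>"
      using G(2) by (auto simp: eventually_at_filter)
  qed
  moreover have "at p within \<Omega> \<noteq> bot"
    using frontier_open_islimpt(2)[OF assms(1) p] by (simp add: trivial_limit_within)
  ultimately have G\<nu>: "G p \<bullet> \<nu> = c" using lim tendsto_unique unfolding \<nu>_def by blast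
  \<comment> \<open>Such a direction enters \<Omega>. A negative derivative along it would make
    \<open>u\<close> non-positive inside, starting from \<open>u p = 0\<close>.\<close>
  have in_cone: "0 \<le> G p \<bullet> v" if v: "\<nu> \<bullet> v < 0" for v
  proof (rule ccontr)
    assume neg: "\<not> 0 \<le> G p \<bullet> v"
    have "grad \<phi> p \<bullet> v < 0" using v g0 by (simp add: \<nu>_def divide_less_0_iff mult_less_0_iff zero_less_divide_iff)
    then obtain t0 where t0: "t0 > 0" "\<And>t. 0 < t \<Longrightarrow> t < t0 \<Longrightarrow> p + t *\<^sub>R v \<in> \<Omega>"
      using inward_segment[OF assms(1) p df] by metis
    have ray: "((\<lambda>t. p + t *\<^sub>R v) \<longlongrightarrow> p + 0 *\<^sub>R v) (at_right 0)" by (intro tendsto_intros)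
    have ev: "\<forall>\<^sub>F t in at_right (0::real). p + t *\<^sub>R v \<in> \<Omega>"
      unfolding eventually_at_right_field using t0 by blast
    have "filterlim (\<lambda>t. p + t *\<^sub>R v) (at p within \<Omega>) (at_right 0)"
      unfolding filterlim_at
      using ray ev frontier_open_islimpt(1)[OF assms(1) p] by (auto elim!: eventually_mono)
    hence "((\<lambda>t. G (p + t *\<^sub>R v) \<bullet> v) \<longlongrightarrow> G p \<bullet> v) (at_right 0)"
      by (intro tendsto_intros filterlim_compose[OF Gp])
    hence "\<forall>\<^sub>F t in at_right 0. G (p + t *\<^sub>R v) \<bullet> v < 0"
      using neg by (intro order_tendstoD) auto
    then obtain t1 where t1: "t1 > 0" "\<And>t. 0 < t \<Longrightarrow> t < t1 \<Longrightarrow> G (p + t *\<^sub>R v) \<bullet> v < 0"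
      unfolding eventually_at_right_field by auto
    define r where "r = min t0 t1 / 2"
    have r: "0 < r" "r < t0" "r < t1" using t0(1) t1(1) by (auto simp: r_def)
    have "u (p + 0 *\<^sub>R v) \<ge> u (p + r *\<^sub>R v)"
    proof (rule DERIV_nonpos_imp_decreasing_open[of 0 r "\<lambda>t. u (p + t *\<^sub>R v)"])
      fix t assume t: "0 < t" "t < r"
      hence t\<Omega>: "p + t *\<^sub>R v \<in> \<Omega>" using t0(2) r by simp
      have "((\<lambda>t. u (p + t *\<^sub>R v)) has_real_derivative G (p + t *\<^sub>R v) \<bullet> v) (at t)"
        unfolding G(2)[OF t\<Omega>] by (intro has_pd_line has_pd_inner_grad diff t\<Omega>)
      moreover have "G (p + t *\<^sub>R v) \<bullet> v \<le> 0" using t1(2)[of t] t r by simp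
      ultimately show "\<exists>y. ((\<lambda>t. u (p + t *\<^sub>R v)) has_real_derivative y) (at t) \<and> y \<le> 0" by blast
    next
      have "p + t *\<^sub>R v \<in> closure \<Omega>" if "t \<in> {0..r}" for t
        using that pc t0(2)[of t] r closure_subset[of \<Omega>] by (cases "t = 0") auto
      thus "continuous_on {0..r} (\<lambda>t. u (p + t *\<^sub>R v))"
        by (intro continuous_on_compose2[OF u] continuous_intros) auto
    qed (use r in auto)
    thus False using pos[OF t0(2)[of r]] r \<open>u p = 0\<close> by simp
  qed
  define q where "q = G p - c *\<^sub>R \<nu>"
  have q\<nu>: "q \<bullet> \<nu> = 0" by (simp add: q_def inner_diff_left G\<nu> \<nu>\<nu>)
  have "q \<bullet> q \<le> 0"
  proof (rule field_le_epsilon)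
    fix e :: real assume e: "e > 0"
    \<comment> \<open>The direction \<open>- q\<close> is only tangential; tilting it by
      \<open>- s *\<^sub>R \<nu>\<close> makes it point inward at a cost of at most
      \<open>e\<close>.\<close>
    define s where "s = e / (\<bar>c\<bar> + 1)"
    have s: "s > 0" using e by (simp add: s_def)
    have "\<nu> \<bullet> (- q - s *\<^sub>R \<nu>) < 0"
      using s q\<nu> by (simp add: inner_diff_right inner_commute[of \<nu> q] \<nu>\<nu>)
    hence "0 \<le> G p \<bullet> (- q - s *\<^sub>R \<nu>)" by (rule in_cone)
    moreover have "G p \<bullet> q = q \<bullet> q"
    proof -
      have "G p \<bullet> q = (q + c *\<^sub>R \<nu>) \<bullet> q" by (simp add: q_def)
      thus ?thesis using q\<nu> by (simp only: inner_add_left inner_scaleR_left inner_commute[of \<nu> q])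
    qed
    ultimately have "q \<bullet> q \<le> - s * c" using G\<nu> by (simp add: inner_diff_right)
    also have "- s * c \<le> s * (\<bar>c\<bar> + 1)" using s mult_left_mono[of "- c" "\<bar>c\<bar> + 1" s] by simp
    also have "\<dots> = e" by (simp add: s_def)
    finally show "q \<bullet> q \<le> 0 + e" by simp
  qed
  hence "q = 0" by (metis antisym inner_eq_zero_iff inner_ge_zero)
  hence "G p = c *\<^sub>R \<nu>" by (simp add: q_def)
  thus ?thesis using n\<nu> by (simp add: power_mult_distrib)
qed

section \<open>Rigidity\<close>

text \<open>Differentiability turns vanishing partial derivatives into a vanishing Frechet
  derivative.\<close>

lemma constant_if_pd_zero:
  fixes f :: "'a::euclidean_space \<Rightarrow> real"
  assumes S: "open S" "connected S" "x \<in> S" "y \<in> S"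
    and diff: "\<And>z. z \<in> S \<Longrightarrow> f differentiable (at z)"
    and pd: "\<And>z b. z \<in> S \<Longrightarrow> b \<in> Basis \<Longrightarrow> has_pd f b 0 z"
  shows "f x = f y"
proof -
  have "(f has_derivative (\<lambda>v. 0)) (at z)" if z: "z \<in> S" for z
  proof -
  have g: "has_pd f v (grad f z \<bullet> v) z" for v by (rule has_pd_inner_grad) (rule diff[OF z])
  have "grad f z \<bullet> b = 0" if "b \<in> Basis" for b
    by (rule has_pd_unique) (rule g, rule pd[OF z that])
  hence "grad f z = 0" by (simp add: euclidean_eq_iff[of "grad f z" 0])
  hence "has_pd f v 0 z" for v using g[of v] by simp
  moreover have "has_pd f v (frechet_derivative f (at z) v) z" for v by (rule has_pd_frechet) (rule diff[OF z])
  ultimately have "frechet_derivative f (at z) v = 0" for v by (rule has_pd_unique[THEN sym])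
  hence "frechet_derivative f (at z) = (\<lambda>v. 0)" by blast
  thus ?thesis
    using diff[OF z] frechet_derivative_works[of f "at z"] by simp
  qed
  thus ?thesis using has_derivative_zero_unique_connected[OF S(1,2) _ S(3,4)] by blast
qed

text \<open>The level set is closed by continuity and open by \<open>loc\<close>.\<close>

lemma connected_level_set:
  fixes f :: "'a::metric_space \<Rightarrow> real"
  assumes "connected S" "continuous_on S f" "x \<in> S" "f x = a"
    and loc: "\<And>z. z \<in> S \<Longrightarrow> f z = a \<Longrightarrow> \<exists>r>0. ball z r \<subseteq> S \<and> (\<forall>y\<in>ball z r. f y = a)"
    and "y \<in> S"
  shows "f y = a"
proof -
  have "open {z \<in> S. f z = a}"
    unfolding open_contains_ball
  proof
    fix z assume "z \<in> {z \<in> S. f z = a}"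
    then obtain r where "r > 0" "ball z r \<subseteq> S" "\<forall>y\<in>ball z r. f y = a" using loc[of z] by auto
    thus "\<exists>r>0. ball z r \<subseteq> {z \<in> S. f z = a}" by (intro exI[of _ r]) auto
  qed
  from continuous_levelset_open[OF assms(1,2) this] assms show ?thesis by blast
qed

section \<open>Propagation of maxima and the structure of extremal solutions\<close>

context semilinear_equation begin

text \<open>As \<open>F\<close> is non-positive, its zero \<open>s0\<close> is a maximum, so
  \<open>f s0 = 0\<close>. A bound for \<open>deriv f\<close> on the interval then gives a linear
  bound for \<open>f\<close> and a quadratic one for \<open>F\<close>.\<close>

lemma F_quadratic_at_zero:
  assumes "F s0 = 0" "s0 \<in> {0..M}"
  obtains C where "C \<ge> 0" "\<And>s. s \<in> {0..M} \<Longrightarrow> - 2 * F s \<le> C\<^sup>2 * (s - s0)\<^sup>2"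
proof -
  have f0: "f s0 = 0"
    by (rule DERIV_local_max[OF F_deriv, of 1]) (use assms F_nonpos in auto)
  have "compact (deriv f ` {0..M})"
    using deriv_f_cont by (intro compact_continuous_image) (auto intro: continuous_on_subset)
  then obtain K where K: "\<And>s. s \<in> {0..M} \<Longrightarrow> norm (deriv f s) \<le> K"
    using compact_imp_bounded[of "deriv f ` {0..M}"] unfolding bounded_iff by blast
  have K0: "K \<ge> 0" using K[OF assms(2)] norm_ge_zero[of "deriv f s0"] by linarith
  have f1: "\<bar>f s\<bar> \<le> K * \<bar>s - s0\<bar>" if s: "s \<in> {0..M}" for s
  proof -
    have "norm (f s - f s0) \<le> K * norm (s - s0)"
      by (rule field_differentiable_bound[of "{0..M}" f "deriv f"])
        (use K s assms(2) in \<open>auto intro: has_field_derivative_at_within f_deriv\<close>)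
    thus ?thesis by (simp add: f0)
  qed
  have "\<bar>F s\<bar> \<le> K * (s - s0)\<^sup>2" if s: "s \<in> {0..M}" for s
  proof -
    have "norm (F s - F s0) \<le> (K * \<bar>s - s0\<bar>) * norm (s - s0)"
    proof (rule field_differentiable_bound[of "closed_segment s0 s" F f])
      fix z assume z: "z \<in> closed_segment s0 s"
      show "(F has_real_derivative f z) (at z within closed_segment s0 s)"
        by (rule has_field_derivative_at_within) (rule F_deriv)
      have "closed_segment s0 s \<subseteq> {0..M}" using s assms(2) by (intro closed_segment_subset) auto
      hence "\<bar>f z\<bar> \<le> K * \<bar>z - s0\<bar>" using f1 z by blast
      also have "\<bar>z - s0\<bar> \<le> \<bar>s - s0\<bar>" using z by (auto simp: closed_segment_eq_real_ivl split: if_splits)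
      finally show "norm (f z) \<le> K * \<bar>s - s0\<bar>" using K0 by (simp add: mult_left_mono)
    qed auto
    thus ?thesis using assms(1) by (simp add: power2_eq_square mult.assoc)
  qed
  note F2 = this
  \<comment> \<open>The constant is a square so that a root can be taken in the gradient
    bound.\<close>
  have "- 2 * F s \<le> (2 * K + 1)\<^sup>2 * (s - s0)\<^sup>2" if s: "s \<in> {0..M}" for s
  proof -
    have "- 2 * F s \<le> (2 * K) * (s - s0)\<^sup>2" using F2[OF s] by linarith
    also have "2 * K \<le> (2 * K + 1)\<^sup>2" using K0 by (simp add: power2_eq_square algebra_simps)
    finally show ?thesis by (simp add: mult_right_mono)
  qed
  thus thesis using that[of "2 * K + 1"] K0 by auto
qed

text \<open>Since \<open>P\<close> is at most 0, the gradient is bounded by a multiple of the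
  difference of \<open>u\<close> from \<open>u p\<close>, and Gronwall's inequality applies along
  the segment. Taking \<open>p\<close> in the closure allows a start at the boundary.\<close>

lemma zero_of_F_propagates:
  assumes u: "continuous_on (closure \<Omega>) u" "\<And>x. x \<in> \<Omega> \<Longrightarrow> 0 < u x" "\<And>x. x \<in> \<Omega> \<Longrightarrow> u x \<le> M"
    and P: "\<And>x. x \<in> \<Omega> \<Longrightarrow> P x \<le> 0"
    and p: "p \<in> closure \<Omega>" "F (u p) = 0" "u p \<in> {0..M}"
    and seg: "\<And>t. 0 < t \<Longrightarrow> t \<le> 1 \<Longrightarrow> p + t *\<^sub>R v \<in> \<Omega>"
  shows "u (p + v) = u p"
proof -
  obtain C where C: "C \<ge> 0" "\<And>s. s \<in> {0..M} \<Longrightarrow> - 2 * F s \<le> C\<^sup>2 * (s - u p)\<^sup>2"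
    using F_quadratic_at_zero[OF p(2,3)] by blast
  have "u (p + 1 *\<^sub>R v) - u p = 0"
  proof (rule gronwall_vanish[where h = "\<lambda>t. u (p + t *\<^sub>R v) - u p" and h' = "\<lambda>t. grad u (p + t *\<^sub>R v) \<bullet> v"
        and C = "C * norm v"])
    have "p + t *\<^sub>R v \<in> closure \<Omega>" if "t \<in> {0..1}" for t
      using that p seg[of t] closure_subset[of \<Omega>] by (cases "t = 0") auto
    thus "continuous_on {0..1} (\<lambda>t. u (p + t *\<^sub>R v) - u p)"
      by (intro continuous_intros continuous_on_compose2[OF u(1)]) auto
  next
    fix t :: real assume t: "0 < t" "t < 1"
    let ?x = "p + t *\<^sub>R v"
    have x: "?x \<in> \<Omega>" using seg t by simp
    have "((\<lambda>t. u (p + t *\<^sub>R v)) has_real_derivative grad u ?x \<bullet> v) (at t)"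
      by (intro has_pd_line has_pd_inner_grad u_differentiable x)
    thus "((\<lambda>t. u (p + t *\<^sub>R v) - u p) has_real_derivative grad u ?x \<bullet> v) (at t)"
      by (auto intro!: derivative_eq_intros)
    have "(norm (grad u ?x))\<^sup>2 \<le> - 2 * F (u ?x)" using P[OF x] by (simp add: P_function_def)
    also have "\<dots> \<le> C\<^sup>2 * (u ?x - u p)\<^sup>2" using u(2,3)[OF x] by (intro C) auto
    also have "\<dots> = (C * \<bar>u ?x - u p\<bar>)\<^sup>2" by (simp add: power_mult_distrib)
    finally have n: "norm (grad u ?x) \<le> C * \<bar>u ?x - u p\<bar>" by (rule power2_le_imp_le) (use C in simp)
    have "\<bar>grad u ?x \<bullet> v\<bar> \<le> norm (grad u ?x) * norm v" by (rule Cauchy_Schwarz_ineq2)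
    also have "\<dots> \<le> C * \<bar>u ?x - u p\<bar> * norm v" using n by (rule mult_right_mono) simp
    finally show "\<bar>grad u ?x \<bullet> v\<bar> \<le> C * norm v * \<bar>u ?x - u p\<bar>" by (simp add: mult_ac)
  qed simp
  thus ?thesis by simp
qed

text \<open>Dividing \<open>bochner\<close> by the squared gradient gives a linear inequality with
  drift \<open>B\<close>, which is bounded on the open set where the gradient exceeds half its
  length at \<open>x\<close>.\<close>

lemma P_max_propagates:
  assumes le: "\<And>x. x \<in> \<Omega> \<Longrightarrow> P x \<le> m" and x: "x \<in> \<Omega>" "P x = m" "grad u x \<noteq> 0"
    and u: "\<And>x. x \<in> \<Omega> \<Longrightarrow> 0 < u x" "\<And>x. x \<in> \<Omega> \<Longrightarrow> u x \<le> M"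
  shows "\<exists>r>0. ball x r \<subseteq> \<Omega> \<and> (\<forall>y\<in>ball x r. P y = m)"
proof -
  have "compact (f ` {0..M})"
    using f_cont by (intro compact_continuous_image) (auto intro: continuous_on_subset)
  then obtain K where K: "\<And>s. s \<in> {0..M} \<Longrightarrow> \<bar>f s\<bar> \<le> K"
    using compact_imp_bounded[of "f ` {0..M}"] unfolding bounded_iff real_norm_def by blast
  define c where "c = norm (grad u x) / 2"
  have c: "c > 0" using x by (simp add: c_def)
  define S where "S = \<Omega> \<inter> (\<lambda>z. norm (grad u z)) -` {c<..}"
  have "continuous_on \<Omega> (\<lambda>z. sqrt (\<Sum>b\<in>Basis. (U b z)\<^sup>2))"
    by (intro continuous_intros U_cont)
  hence "continuous_on \<Omega> (\<lambda>z. norm (grad u z))" by (simp flip: norm_grad)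
  hence S: "open S" unfolding S_def using open_dom by (intro continuous_open_preimage) auto
  have xS: "x \<in> S" using x c by (auto simp: S_def c_def)
  define B where "B = (\<lambda>z. (2 * f (u z) / (norm (grad u z))\<^sup>2) *\<^sub>R grad u z)"
  have "\<exists>r>0. ball x r \<subseteq> S \<and> (\<forall>y\<in>ball x r. P y = m)"
  proof (rule strong_maximum_principle_local[of S x P P1 P2 B "2 * K / c" m])
    show "open S" "x \<in> S" "P x = m" by fact+
    show "continuous_on S P" using P_cont by (rule continuous_on_subset) (auto simp: S_def)
    fix z assume "z \<in> S"
    hence z: "z \<in> \<Omega>" and gz: "norm (grad u z) > c" by (auto simp: S_def)
    show "P z \<le> m" using le z by simp
    show "has_pd P b (P1 b z) z" "has_pd (P1 b) b (P2 b z) z" for b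
      using has_pd_P has_pd_P1 z by auto
    have a: "0 < (norm (grad u z))\<^sup>2" using gz c by (intro zero_less_power) linarith
    have "(\<Sum>b\<in>Basis. (B z \<bullet> b) * P1 b z) = B z \<bullet> gradP z"
      by (simp add: gradP_inner flip: sum_Basis_inner_mult[of "B z" "gradP z"])
    also have "\<dots> = 2 * f (u z) * (grad u z \<bullet> gradP z) / (norm (grad u z))\<^sup>2" by (simp add: B_def)
    finally have "(norm (grad u z))\<^sup>2 * ((\<Sum>b\<in>Basis. P2 b z) + (\<Sum>b\<in>Basis. (B z \<bullet> b) * P1 b z))
        = (norm (grad u z))\<^sup>2 * (\<Sum>b\<in>Basis. P2 b z) + 2 * f (u z) * (grad u z \<bullet> gradP z)"
      using a by (simp add: distrib_left)
    also have "\<dots> \<ge> 0" using bochner[OF z] zero_le_power2[of "norm (gradP z)"] by linarith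
    finally show "0 \<le> (\<Sum>b\<in>Basis. P2 b z) + (\<Sum>b\<in>Basis. (B z \<bullet> b) * P1 b z)"
      using a by (simp add: zero_le_mult_iff)
    have "norm (B z) = 2 * \<bar>f (u z)\<bar> / norm (grad u z)"
      using gz c by (simp add: B_def abs_mult power2_eq_square)
    also have "\<dots> \<le> 2 * K / c" using K[of "u z"] u[OF z] gz c by (intro frac_le) auto
    finally show "norm (B z) \<le> 2 * K / c" .
  qed
  thus ?thesis by (auto simp: S_def)
qed

text \<open>At an interior maximum of \<open>u\<close> minus a small quadratic penalty, the gradient
  of \<open>u\<close> equals that of the penalty. The zero boundary values keep the maximum off the
  frontier, and the bound \<open>M\<close> keeps it off the sphere.\<close>

lemma gradient_not_bounded_below:
  assumes u: "continuous_on (closure \<Omega>) u" "\<And>x. x \<in> \<Omega> \<Longrightarrow> 0 < u x" "\<And>x. x \<in> \<Omega> \<Longrightarrow> u x \<le> M"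
    and bdry: "\<And>x. x \<in> frontier \<Omega> \<Longrightarrow> u x = 0"
    and x0: "x0 \<in> \<Omega>" and m: "0 < m"
  shows "\<exists>y\<in>\<Omega>. (norm (grad u y))\<^sup>2 < m"
proof -
  have M: "M > 0" using u(2,3)[OF x0] by linarith
  \<comment> \<open>Makes the bound \<open>4 * \<mu> * M\<close> for the squared gradient equal to
    \<open>m / 2\<close>.\<close>
  define \<mu> where "\<mu> = m / (8 * M)"
  have \<mu>: "\<mu> > 0" using M m by (simp add: \<mu>_def)
  \<comment> \<open>At distance \<open>r\<close> the penalty is \<open>2 * M\<close> and outweighs
    \<open>u\<close>.\<close>
  define r where "r = sqrt (2 * M / \<mu>)"
  have r: "r > 0" "\<mu> * r\<^sup>2 = 2 * M" using M \<mu> by (auto simp: r_def)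
  define w where "w = (\<lambda>x. u x + (- \<mu>) * (norm (x - x0))\<^sup>2)"
  define T where "T = closure \<Omega> \<inter> cball x0 r"
  have "compact T" unfolding T_def by (intro closed_Int_compact) auto
  moreover have x0T: "x0 \<in> T" using x0 r closure_subset by (auto simp: T_def)
  moreover have "continuous_on T w"
    unfolding w_def by (intro continuous_intros continuous_on_subset[OF u(1)]) (auto simp: T_def)
  ultimately obtain y where y: "y \<in> T" "\<And>z. z \<in> T \<Longrightarrow> w z \<le> w y"
    using continuous_attains_sup[of T w] by blast
  have "0 < w x0" using u(2)[OF x0] by (simp add: w_def)
  hence wy: "0 < w y" using y(2)[OF x0T] by simp
  have "y \<notin> frontier \<Omega>" 
  proof
    assume "y \<in> frontier \<Omega>"
    moreover have "0 \<le> \<mu> * (norm (y - x0))\<^sup>2" using \<mu> by simp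
    ultimately show False using wy bdry[of y] by (simp add: w_def)
  qed
  hence y\<Omega>: "y \<in> \<Omega>" using y(1) by (auto simp: T_def closure_Un_frontier)
  have "\<mu> * (norm (y - x0))\<^sup>2 < u y" using wy by (simp add: w_def)
  hence small: "\<mu> * (norm (y - x0))\<^sup>2 < M" using u(3)[OF y\<Omega>] by simp
  have "norm (y - x0) \<noteq> r" using small r M by auto
  hence yr: "dist x0 y < r" using y(1) by (auto simp: T_def dist_norm norm_minus_commute)
  define S where "S = \<Omega> \<inter> ball x0 r"
  have S: "open S" "y \<in> S" using open_dom y\<Omega> yr by (auto simp: S_def)
  have crit: "U b y + (- \<mu>) * (2 * ((y - x0) \<bullet> b)) = 0" for b
  proof (rule local_max_pd(1)[of S y w b "\<lambda>z. U b z + (- \<mu>) * (2 * ((z - x0) \<bullet> b))", OF S])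
    show "w z \<le> w y" if "z \<in> S" for z
      using that closure_subset[of \<Omega>] by (intro y) (auto simp: T_def S_def)
    show "has_pd w b (U b z + (- \<mu>) * (2 * ((z - x0) \<bullet> b))) z" if "z \<in> S" for z
      unfolding w_def using that by (intro has_pd_add_scaled has_pd_u has_pd_dist_squared) (auto simp: S_def)
    have "has_pd (\<lambda>z. 2 * ((z - x0) \<bullet> b)) b (2 * (b \<bullet> b)) y"
      unfolding has_pd_def by (auto simp: inner_simps intro!: derivative_eq_intros)
    thus "has_pd (\<lambda>z. U b z + (- \<mu>) * (2 * ((z - x0) \<bullet> b))) b (U2 b b y + (- \<mu>) * (2 * (b \<bullet> b))) y"
      by (intro has_pd_add_scaled has_pd_U y\<Omega>)
  qed
  have "grad u y = (2 * \<mu>) *\<^sub>R (y - x0)"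
    by (rule euclidean_eqI) (use crit in \<open>simp add: grad_inner\<close>)
  hence "(norm (grad u y))\<^sup>2 = (4 * \<mu>) * (\<mu> * (norm (y - x0))\<^sup>2)"
    by (simp add: power_mult_distrib power2_eq_square)
  also have "\<dots> < (4 * \<mu>) * M" using small \<mu> by simp
  also have "\<dots> < m" using M m by (simp add: \<mu>_def)
  finally show ?thesis using y\<Omega> by blast
qed

text \<open>Equality in the Cauchy-Schwarz inequality behind the Bochner inequality forces the Hessian to be
  a multiple of the projection onto the gradient.\<close>

lemma hessian_rank_one:
  assumes P0: "\<And>x. x \<in> \<Omega> \<Longrightarrow> P x = m" and x: "x \<in> \<Omega>" and g: "grad u x \<noteq> 0"
    and bc: "b \<in> Basis" "i \<in> Basis"
  shows "U2 i b x = - f (u x) * U i x * U b x / (norm (grad u x))\<^sup>2"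
proof -
  define a where "a = (norm (grad u x))\<^sup>2"
  have a: "a > 0" using g by (simp add: a_def)
  have P10: "P1 b z = 0" if "z \<in> \<Omega>" for b z
  proof -
    have "has_pd (\<lambda>_. m) b (P1 b z) z"
      by (rule has_pd_cong_open[OF open_dom that P0 has_pd_P[OF that]])
    moreover have "has_pd (\<lambda>_. m) b 0 z" by (simp add: has_pd_def)
    ultimately show ?thesis by (rule has_pd_unique)
  qed
  have P20: "P2 b x = 0" for b
  proof -
    have "has_pd (\<lambda>_. 0) b (P2 b x) x"
      by (rule has_pd_cong_open[OF open_dom x P10 has_pd_P1[OF x]])
    moreover have "has_pd (\<lambda>_. 0) b 0 x" by (simp add: has_pd_def)
    ultimately show ?thesis by (rule has_pd_unique)
  qed
  have V: "(\<Sum>i\<in>Basis. U i x * U2 i b x) = - f (u x) * U b x" for b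
    using P10[OF x, of b] by (simp add: P1_def)
  have H: "(\<Sum>b\<in>Basis. \<Sum>i\<in>Basis. (U2 i b x)\<^sup>2) = (f (u x))\<^sup>2"
    using sum_P2[OF x] P20 by simp
  have UU: "(\<Sum>b\<in>Basis. (U b x)\<^sup>2) = a" by (simp add: a_def norm_grad)
  \<comment> \<open>With this \<open>c\<close> the sum of squares below is
    \<open>(f (u x))\<^sup>2\<close> times \<open>1 - 2 + 1\<close>.\<close>
  define c where "c = f (u x) / a"
  have ca: "c * a = f (u x)" using a by (simp add: c_def)
  have "(p + c * v * w)\<^sup>2 = p\<^sup>2 + 2 * c * w * (v * p) + c\<^sup>2 * w\<^sup>2 * v\<^sup>2" for p v w :: real
    by algebra
  hence "(\<Sum>b\<in>Basis. \<Sum>i\<in>Basis. (U2 i b x + c * U i x * U b x)\<^sup>2)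
      = (\<Sum>b\<in>Basis. \<Sum>i\<in>Basis. (U2 i b x)\<^sup>2
          + 2 * c * U b x * (U i x * U2 i b x) + c\<^sup>2 * (U b x)\<^sup>2 * (U i x)\<^sup>2)"
    by presburger
  also have "\<dots> = (\<Sum>b\<in>Basis. \<Sum>i\<in>Basis. (U2 i b x)\<^sup>2)
        + (\<Sum>b\<in>Basis. 2 * c * U b x * (\<Sum>i\<in>Basis. U i x * U2 i b x))
        + (\<Sum>b\<in>Basis. c\<^sup>2 * (U b x)\<^sup>2 * (\<Sum>i\<in>Basis. (U i x)\<^sup>2))"
    by (simp only: sum.distrib sum_distrib_left)
  also have "(\<Sum>b\<in>Basis. 2 * c * U b x * (\<Sum>i\<in>Basis. U i x * U2 i b x))
      = (\<Sum>b\<in>Basis. - 2 * c * f (u x) * (U b x)\<^sup>2)"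
    unfolding V by (intro sum.cong refl) algebra
  also have "\<dots> = - 2 * c * f (u x) * a"
    unfolding sum_distrib_left[symmetric] UU ..
  also have "(\<Sum>b\<in>Basis. c\<^sup>2 * (U b x)\<^sup>2 * (\<Sum>i\<in>Basis. (U i x)\<^sup>2)) = c\<^sup>2 * a * a"
    unfolding UU sum_distrib_left[symmetric] sum_distrib_right[symmetric] ..
  also have "(\<Sum>b\<in>Basis. \<Sum>i\<in>Basis. (U2 i b x)\<^sup>2) + - 2 * c * f (u x) * a + c\<^sup>2 * a * a = 0"
    unfolding H ca[symmetric] by algebra
  finally have "(\<Sum>b\<in>Basis. \<Sum>i\<in>Basis. (U2 i b x + c * U i x * U b x)\<^sup>2) = 0" .
  hence "(\<Sum>i\<in>Basis. (U2 i b x + c * U i x * U b x)\<^sup>2) = 0"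
    using bc by (simp add: sum_nonneg_eq_0_iff sum_nonneg)
  hence "(U2 i b x + c * U i x * U b x)\<^sup>2 = 0"
    using bc by (simp add: sum_nonneg_eq_0_iff)
  thus ?thesis by (simp add: c_def a_def)
qed

text \<open>As \<open>P = 0\<close>, the length of the gradient is
  \<open>sqrt (- 2 * F (u x))\<close>, a function of \<open>u\<close> alone. The components of the
  gradient divided by it have zero derivatives by \<open>hessian_rank_one\<close>.\<close>

lemma gradient_direction_constant:
  assumes conn: "connected \<Omega>" and P0: "\<And>x. x \<in> \<Omega> \<Longrightarrow> P x = 0"
    and g: "\<And>x. x \<in> \<Omega> \<Longrightarrow> grad u x \<noteq> 0" and "\<Omega> \<noteq> {}"
  obtains e where "norm e = 1" "\<And>x. x \<in> \<Omega> \<Longrightarrow> grad u x = sqrt (- 2 * F (u x)) *\<^sub>R e"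
proof -
  define r where "r = (\<lambda>x. sqrt (- 2 * F (u x)))"
  have n: "(norm (grad u x))\<^sup>2 = - 2 * F (u x)" if "x \<in> \<Omega>" for x
    using P0[OF that] by (simp add: P_function_def)
  have F: "0 < - 2 * F (u x)" if "x \<in> \<Omega>" for x
  proof -
    have "0 < (norm (grad u x))\<^sup>2" using g[OF that] by simp
    thus ?thesis by (simp only: n[OF that])
  qed
  have r: "r x > 0" "(r x)\<^sup>2 = - 2 * F (u x)" if "x \<in> \<Omega>" for x
    using F[OF that] by (auto simp: r_def)
  have dr: "((\<lambda>s. inverse (sqrt (- 2 * F s))) has_real_derivative f (u x) / (r x) ^ 3) (at (u x))"
    if x: "x \<in> \<Omega>" for x
  proof -
    have "((\<lambda>s. - 2 * F s) has_real_derivative - 2 * f (u x)) (at (u x))"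
      by (rule DERIV_cmult) (rule F_deriv)
    hence s: "((\<lambda>s. sqrt (- 2 * F s)) has_real_derivative inverse (r x) / 2 * (- 2 * f (u x))) (at (u x))"
      unfolding r_def
      using DERIV_chain2[where f = sqrt and g = "\<lambda>s. - 2 * F s" and x = "u x", OF DERIV_real_sqrt[OF F[OF x]]] by blast
    have rx: "sqrt (- 2 * F (u x)) = r x" by (simp add: r_def)
    have "sqrt (- 2 * F (u x)) \<noteq> 0" using r(1)[OF x] unfolding rx by simp
    from DERIV_inverse'[OF s this] show ?thesis
      by (rule DERIV_cong, unfold rx) (use r(1)[OF x] in \<open>simp add: field_simps power3_eq_cube\<close>)
  qed
  define T where "T = (\<lambda>i x. inverse (r x) * U i x)"
  have const: "T i x = T i y" if "i \<in> Basis" "x \<in> \<Omega>" "y \<in> \<Omega>" for i x y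
  proof (rule constant_if_pd_zero[OF open_dom conn that(2,3)])
    fix z assume z: "z \<in> \<Omega>"
    have u: "(u has_derivative frechet_derivative u (at z)) (at z)"
      using u_differentiable[OF z] by (simp add: frechet_derivative_works)
    have "(\<lambda>x. inverse (r x)) differentiable (at z)"
      unfolding differentiable_def r_def
      using has_derivative_compose[OF u, of "\<lambda>s. inverse (sqrt (- 2 * F s))"]
        dr[OF z, unfolded has_field_derivative_def] by blast
    moreover have "U i differentiable (at z)" by (rule Ck_on_SucD(1)[OF U_C2 z])
    ultimately show "T i differentiable (at z)" unfolding T_def by (rule differentiable_mult)
    fix b :: 'a assume b: "b \<in> Basis"
    have "has_pd (\<lambda>x. inverse (r x)) b (f (u z) / (r z) ^ 3 * U b z) z"
      unfolding r_def by (rule has_pd_compose[OF dr[OF z, unfolded r_def] has_pd_u[OF z]])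
    hence d: "has_pd (T i) b (f (u z) / (r z) ^ 3 * U b z * U i z + U2 i b z * inverse (r z)) z"
      unfolding T_def using has_pd_U[OF z, of i b] DERIV_mult unfolding has_pd_def by fastforce
    have "U2 i b z = - f (u z) * U i z * U b z / (r z)\<^sup>2"
      using hessian_rank_one[OF P0 z g[OF z] b that(1)] n[OF z] r(2)[OF z] by simp
    hence "f (u z) / (r z) ^ 3 * U b z * U i z + U2 i b z * inverse (r z) = 0"
      using r(1)[OF z] by (simp add: field_simps power2_eq_square power3_eq_cube)
    thus "has_pd (T i) b 0 z" using d by simp
  qed
  obtain x0 where x0: "x0 \<in> \<Omega>" using \<open>\<Omega> \<noteq> {}\<close> by blast
  define e where "e = inverse (r x0) *\<^sub>R grad u x0"
  have eq: "grad u x = r x *\<^sub>R e" if x: "x \<in> \<Omega>" for x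
  proof (rule euclidean_eqI)
    fix b :: 'a assume b: "b \<in> Basis"
    have "inverse (r x) * U b x = e \<bullet> b"
      using const[OF b x x0] by (simp add: T_def e_def grad_inner[OF b])
    thus "grad u x \<bullet> b = r x *\<^sub>R e \<bullet> b" using r(1)[OF x] grad_inner[OF b, of x] by (simp add: field_simps)
  qed
  have "(norm (grad u x0))\<^sup>2 = (r x0)\<^sup>2" using n r x0 by simp
  hence "norm (grad u x0) = r x0" using r(1)[OF x0] by (simp add: power2_eq_iff_nonneg)
  hence "norm e = 1" using r(1)[OF x0] by (simp add: e_def)
  thus thesis using that eq by (simp add: r_def)
qed

text \<open>Here \<open>\<Psi>\<close> is a primitive of \<open>1 / sqrt (- 2 F)\<close>, started slightly to the left of 0. It turns
  \<open>u\<close> into an affine function.\<close>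

lemma rigidity_zero:
  assumes conn: "connected \<Omega>" and "\<Omega> \<noteq> {}" and p0: "p0 \<in> frontier \<Omega>"
    and u: "continuous_on (closure \<Omega>) u" "\<And>x. x \<in> \<Omega> \<Longrightarrow> 0 < u x"
    and bdry: "\<And>x. x \<in> frontier \<Omega> \<Longrightarrow> u x = 0"
    and P0: "\<And>x. x \<in> \<Omega> \<Longrightarrow> P x = 0" and g: "\<And>x. x \<in> \<Omega> \<Longrightarrow> grad u x \<noteq> 0"
    and F0: "F 0 < 0"
  shows "one_dimensional_on \<Omega> u \<and> half_space \<Omega>"
proof -
  obtain e where e: "norm e = 1" "\<And>x. x \<in> \<Omega> \<Longrightarrow> grad u x = sqrt (- 2 * F (u x)) *\<^sub>R e"
    using gradient_direction_constant[OF conn P0 g \<open>\<Omega> \<noteq> {}\<close>] by metis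
  have near: "\<exists>\<delta>>0. \<forall>t. \<bar>t - s\<bar> < \<delta> \<longrightarrow> F t < 0" if "F s < 0" for s
  proof -
    have "isCont F s" using F_deriv by (rule DERIV_isCont)
    hence "\<forall>\<^sub>F t in at s. F t < 0" using that by (auto simp: isCont_def intro: order_tendstoD)
    thus ?thesis unfolding eventually_at using that by (auto simp: dist_real_def)
  qed
  obtain \<delta> where \<delta>: "\<delta> > 0" "\<And>t. \<bar>t\<bar> < \<delta> \<Longrightarrow> F t < 0" using near[OF F0] by auto
  \<comment> \<open>Starting left of 0 makes \<Psi> differentiable from both sides at the boundary
    value 0.\<close>
  define a where "a = - \<delta> / 2"
  have a: "a < 0" using \<delta> by (simp add: a_def)
  define J where "J = {s. a < s \<and> (\<forall>t\<in>{a..s}. F t < 0)}"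
  have u_range: "F t < 0" if x: "x \<in> \<Omega>" and t: "a \<le> t" "t \<le> u x" for x t
  proof (cases "t \<le> 0")
    case True
    thus ?thesis using t \<delta> by (auto simp: a_def)
  next
    case False
    \<comment> \<open>Adjoining \<open>p0\<close> makes 0 a value of \<open>u\<close> on a connected
      set. Every \<open>t\<close> between 0 and \<open>u x\<close> is then attained in \<Omega>,
      where a nonzero gradient and \<open>P = 0\<close> give \<open>F t < 0\<close>.\<close>
    have "connected (insert p0 \<Omega>)"
      by (rule connected_intermediate_closure[OF conn]) (use p0 closure_subset in \<open>auto simp: frontier_def\<close>)
    moreover have sub: "insert p0 \<Omega> \<subseteq> closure \<Omega>" using p0 closure_subset by (auto simp: frontier_def)
    ultimately have "connected (u ` insert p0 \<Omega>)"
      using connected_continuous_image continuous_on_subset[OF u(1)] by blast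
    moreover have "0 \<in> u ` insert p0 \<Omega>" "u x \<in> u ` insert p0 \<Omega>" using bdry[OF p0] x by auto
    ultimately have "{0..u x} \<subseteq> u ` insert p0 \<Omega>" by (rule connected_contains_Icc)
    moreover have "t \<in> {0..u x}" using False t by simp
    ultimately have "t \<in> u ` insert p0 \<Omega>" by blast
    then obtain y where y: "y \<in> \<Omega>" "t = u y" using False bdry[OF p0] by force
    have "0 < (norm (grad u y))\<^sup>2" using g[OF y(1)] by simp
    thus ?thesis using P0[OF y(1)] unfolding P_function_def y(2) by linarith
  qed
  have 0: "0 \<in> J" using a \<delta> by (auto simp: J_def a_def)
  have uJ: "u x \<in> J" if "x \<in> closure \<Omega>" for x
  proof (cases "x \<in> \<Omega>")
    case True
    thus ?thesis using u_range[OF True] u(2)[OF True] a by (auto simp: J_def)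
  next
    case False
    hence "u x = 0" using that bdry by (auto simp: closure_Un_frontier)
    thus ?thesis using 0 by simp
  qed
  have J_down: "t \<in> J" if "s \<in> J" "a < t" "t \<le> s" for s t using that by (auto simp: J_def)
  define \<psi> where "\<psi> = (\<lambda>s. inverse (sqrt (- 2 * F s)))"
  define \<Psi> where "\<Psi> = (\<lambda>s. integral {a..s} \<psi>)"
  have \<Psi>: "(\<Psi> has_real_derivative \<psi> s) (at s)" if s: "s \<in> J" for s
  proof -
    have "F s < 0" using s by (auto simp: J_def)
    then obtain d where d: "d > 0" "\<And>t. \<bar>t - s\<bar> < d \<Longrightarrow> F t < 0" using near by blast
    \<comment> \<open>Integrating slightly past \<open>s\<close> makes it an interior point, which
      gives the two-sided derivative.\<close>
    define s' where "s' = s + d / 2"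
    have s': "s < s'" using d by (simp add: s'_def)
    have neg: "F t < 0" if "t \<in> {a..s'}" for t
      using that s d(1) d(2)[of t] by (cases "t \<le> s") (auto simp: J_def s'_def)
    have "continuous_on {a..s'} \<psi>" unfolding \<psi>_def
      by (intro continuous_intros continuous_on_subset[OF F_cont]) (use neg in force)+
    hence "(\<Psi> has_real_derivative \<psi> s) (at s within {a..s'})"
      unfolding \<Psi>_def by (rule integral_has_real_derivative) (use s s' in \<open>auto simp: J_def\<close>)
    moreover have "at s within {a..s'} = at s"
      by (rule at_within_interior) (use s s' in \<open>auto simp: J_def\<close>)
    ultimately show ?thesis by simp
  qed
  have \<psi>_pos: "\<psi> s > 0" if "s \<in> J" for s using that by (auto simp: J_def \<psi>_def)
  have mono: "\<Psi> s < \<Psi> t" if "s \<in> J" "t \<in> J" "s < t" for s t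
  proof (rule DERIV_pos_imp_increasing[OF that(3)])
    fix r assume "s \<le> r" "r \<le> t"
    hence "r \<in> J" using J_down[OF that(2), of r] that(1) by (simp add: J_def)
    thus "\<exists>y. (\<Psi> has_real_derivative y) (at r) \<and> 0 < y" using \<Psi> \<psi>_pos by blast
  qed
  \<comment> \<open>The factor \<psi> cancels the length of the gradient of \<open>u\<close>, so
    \<open>\<Psi> (u x)\<close> has gradient \<open>e\<close>.\<close>
  define \<Phi> where "\<Phi> = (\<lambda>x. \<Psi> (u x) - e \<bullet> x)"
  have d\<Phi>: "(\<Phi> has_derivative (\<lambda>h. 0)) (at x)" if x: "x \<in> \<Omega>" for x
  proof -
    have uJx: "u x \<in> J" using uJ x closure_subset by blast
    have du: "(u has_derivative frechet_derivative u (at x)) (at x)"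
      using u_differentiable[OF x] by (simp add: frechet_derivative_works)
    have fr: "frechet_derivative u (at x) h = sqrt (- 2 * F (u x)) * (e \<bullet> h)" for h
      using has_pd_unique[OF has_pd_inner_grad[OF u_differentiable[OF x]] has_pd_u[OF x], of h]
      by (simp add: e(2)[OF x] U_def)
    have "((\<lambda>x. \<Psi> (u x)) has_derivative (\<lambda>h. \<psi> (u x) * frechet_derivative u (at x) h)) (at x)"
      using has_derivative_compose[OF du, of \<Psi>] \<Psi>[OF uJx, unfolded has_field_derivative_def] by blast
    hence "(\<Phi> has_derivative (\<lambda>h. \<psi> (u x) * frechet_derivative u (at x) h - e \<bullet> h)) (at x)"
      unfolding \<Phi>_def by (intro derivative_intros)
    moreover have "\<psi> (u x) * frechet_derivative u (at x) h - e \<bullet> h = 0" for h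
      using \<psi>_pos[OF uJx] unfolding fr \<psi>_def by (simp add: field_simps)
    ultimately show ?thesis by simp
  qed
  obtain x0 where x0: "x0 \<in> \<Omega>" using \<open>\<Omega> \<noteq> {}\<close> by blast
  have \<Phi>_const: "\<Phi> x = \<Phi> x0" if "x \<in> \<Omega>" for x
    using has_derivative_zero_unique_connected[OF open_dom conn d\<Phi> that x0] .
  have "continuous_on J \<Psi>" using \<Psi> by (meson DERIV_isCont continuous_at_imp_continuous_on)
  hence "continuous_on (closure \<Omega>) \<Phi>"
    unfolding \<Phi>_def by (intro continuous_intros continuous_on_compose2[OF _ u(1)]) (use uJ in auto)
  hence \<Phi>_const': "\<Phi> x = \<Phi> x0" if "x \<in> closure \<Omega>" for x
    using continuous_constant_on_closure[of \<Omega> \<Phi>] \<Phi>_const that by blast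
  have inj: "u x = u y" if "x \<in> \<Omega>" "y \<in> \<Omega>" "e \<bullet> x = e \<bullet> y" for x y
  proof -
    have "\<Psi> (u x) = \<Psi> (u y)" using \<Phi>_const[OF that(1)] \<Phi>_const[OF that(2)] that(3) by (simp add: \<Phi>_def)
    moreover have "u x \<in> J" "u y \<in> J" using that uJ closure_subset by blast+
    ultimately show ?thesis using mono[of "u x" "u y"] mono[of "u y" "u x"] by (cases "u x" "u y" rule: linorder_cases) auto
  qed
  have "one_dimensional_on \<Omega> u"
    unfolding one_dimensional_on_def
  proof (intro exI ballI)
    fix x assume x: "x \<in> \<Omega>"
    \<comment> \<open>Any point of \<Omega> at height \<open>t\<close> will do; \<open>inj\<close>
      makes the value independent of the choice.\<close>
    let ?g = "\<lambda>t. u (SOME y. y \<in> \<Omega> \<and> e \<bullet> y = t)"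
    have "(SOME y. y \<in> \<Omega> \<and> e \<bullet> y = e \<bullet> x) \<in> \<Omega> \<and> e \<bullet> (SOME y. y \<in> \<Omega> \<and> e \<bullet> y = e \<bullet> x) = e \<bullet> x"
      by (rule someI[of _ x]) (use x in simp)
    thus "u x = ?g (e \<bullet> (x - 0))" using inj[OF x] by simp
  qed
  moreover have "half_space \<Omega>"
  proof -
    define c where "c = \<Psi> 0 - \<Phi> x0"
    \<comment> \<open>Constancy of \<Phi> on the closure puts the whole frontier in one
      hyperplane.\<close>
    have fr: "e \<bullet> x = c" if "x \<in> frontier \<Omega>" for x
      using \<Phi>_const'[of x] bdry[OF that] that by (simp add: \<Phi>_def c_def frontier_def)
    have in_H: "c < e \<bullet> x" if "x \<in> \<Omega>" for x
    proof -
      have "\<Psi> 0 < \<Psi> (u x)" using mono[OF 0 _ u(2)[OF that]] uJ that closure_subset by blast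
      thus ?thesis using \<Phi>_const[OF that] by (simp add: \<Phi>_def c_def)
    qed
    define H where "H = {x. c < e \<bullet> x}"
    have "connected H" unfolding H_def by (intro convex_connected) (simp add: convex_halfspace_gt)
    moreover have "H \<inter> \<Omega> \<noteq> {}" using in_H x0 by (auto simp: H_def)
    moreover have "H \<inter> frontier \<Omega> = {}" using fr by (auto simp: H_def)
    \<comment> \<open>The half-space is connected, meets \<Omega> and misses its frontier, so it
      lies in \<Omega>.\<close>
    ultimately have "H - \<Omega> = {}" using connected_Int_frontier by blast
    hence "\<Omega> = {x. (- e) \<bullet> x < - c}" using in_H by (auto simp: H_def)
    moreover have "- e \<noteq> 0" using e(1) by auto
    ultimately show ?thesis unfolding half_space_def by blast
  qed
  ultimately show ?thesis by blast
qed

text \<open>Excluding critical points where \<open>P = m\<close> comes first, as the strong maximum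
  principle depends on it. Constancy of \<open>P\<close> then yields \<open>m = 0\<close>, and only
  with \<open>m = 0\<close> does Gronwall's inequality rule out \<open>F 0 = 0\<close>;
  \<open>rigidity_zero\<close> finishes.\<close>

lemma rigidity:
  assumes conn: "connected \<Omega>" and p0: "p0 \<in> frontier \<Omega>"
    and u: "continuous_on (closure \<Omega>) u" "\<And>x. x \<in> \<Omega> \<Longrightarrow> 0 < u x" "\<And>x. x \<in> \<Omega> \<Longrightarrow> u x \<le> M"
    and bdry: "\<And>x. x \<in> frontier \<Omega> \<Longrightarrow> u x = 0"
    and inward: "\<And>t. 0 < t \<Longrightarrow> t \<le> 1 \<Longrightarrow> p0 + t *\<^sub>R v \<in> \<Omega>"
    and le: "\<And>x. x \<in> \<Omega> \<Longrightarrow> P x \<le> m" and m: "0 \<le> m" and x0: "x0 \<in> \<Omega>" "P x0 = m"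
  shows "P constant_on \<Omega> \<and> one_dimensional_on \<Omega> u \<and> half_space \<Omega>"
proof -
  have M: "M > 0" using u(2,3)[OF x0(1)] by linarith
  have g: "grad u x \<noteq> 0" if x: "x \<in> \<Omega>" "P x = m" for x
  proof
    assume "grad u x = 0"
    hence "P x = 2 * F (u x)" by (simp add: P_function_def)
    hence m0: "m = 0" and Fx: "F (u x) = 0" using x(2) m F_nonpos[of "u x"] by auto
    have "u y = u x" if y: "y \<in> \<Omega>" for y
    proof (rule connected_level_set[OF conn u_cont x(1) refl _ y])
      fix z assume z: "z \<in> \<Omega>" "u z = u x"
      obtain r where r: "r > 0" "ball z r \<subseteq> \<Omega>" using open_dom z openE by blast
      have "u w = u x" if w: "w \<in> ball z r" for w
      proof -
        have "u (z + (w - z)) = u z"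
        proof (rule zero_of_F_propagates[OF u])
          show "P x \<le> 0" if "x \<in> \<Omega>" for x using le[OF that] m0 by simp
          show "z \<in> closure \<Omega>" using z closure_subset by blast
          show "F (u z) = 0" using Fx z by simp
          show "u z \<in> {0..M}" using u(2,3)[OF z(1)] by simp
          fix t :: real assume t: "0 < t" "t \<le> 1"
          have "t * norm (w - z) \<le> norm (w - z)" using t by (simp add: mult_left_le_one_le)
          hence "z + t *\<^sub>R (w - z) \<in> ball z r" using w t by (simp add: dist_norm norm_minus_commute)
          thus "z + t *\<^sub>R (w - z) \<in> \<Omega>" using r by blast
        qed
        thus ?thesis using z by simp
      qed
      thus "\<exists>r>0. ball z r \<subseteq> \<Omega> \<and> (\<forall>y\<in>ball z r. u y = u x)" using r by blast
    qed
    moreover have "p0 \<in> closure \<Omega>" using p0 by (simp add: frontier_def)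
    ultimately have "u p0 = u x" by (rule continuous_constant_on_closure[OF u(1)])
    thus False using bdry[OF p0] u(2)[OF x(1)] by simp
  qed
  have Pm: "P y = m" if y: "y \<in> \<Omega>" for y
    by (rule connected_level_set[OF conn P_cont x0 _ y])
      (rule P_max_propagates[OF le _ _ g u(2,3)])
  have m0: "m = 0"
  proof (rule ccontr)
    assume "m \<noteq> 0"
    then obtain y where "y \<in> \<Omega>" "(norm (grad u y))\<^sup>2 < m"
      using gradient_not_bounded_below[OF u bdry x0(1), of m] m by auto
    thus False using P_le_norm_grad[of y] Pm[of y] by simp
  qed
  have "F 0 \<noteq> 0"
  proof
    assume F0: "F 0 = 0"
    \<comment> \<open>Gronwall's inequality would carry the boundary value 0 along the inward
      segment to a point of \<Omega>.\<close>
    have "u (p0 + v) = u p0"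
    proof (rule zero_of_F_propagates[OF u _ _ _ _ inward])
      show "P x \<le> 0" if "x \<in> \<Omega>" for x using le[OF that] m0 by simp
    qed (use p0 bdry[OF p0] F0 M in \<open>auto simp: frontier_def\<close>)
    thus False using bdry[OF p0] u(2)[of "p0 + v"] inward[of 1] by simp
  qed
  hence F0: "F 0 < 0" using F_nonpos[of 0] by simp
  have "one_dimensional_on \<Omega> u \<and> half_space \<Omega>"
    by (rule rigidity_zero[OF conn _ p0 u(1,2) bdry _ _ F0]) (use x0 Pm m0 g in auto)
  thus ?thesis using Pm by (auto simp: constant_on_def)
qed

end

section \<open>The estimate and the rigidity result combined with the boundary data\<close>

theorem theorem1p2:
  fixes \<Omega> :: "(real ^ 'n) set"
    and F f :: "real \<Rightarrow> real"
    and \<kappa> :: real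
    and u :: "real ^ 'n \<Rightarrow> real"
  assumes "CARD('n) \<ge> 2"
    and "regular_domain \<Omega>"
    and "Ck_on 2 F UNIV"
    and "\<And>t. F t \<le> 0"
    and "f = deriv F"
    and "Ck_on 3 u \<Omega>"
    and "C1_up_to_boundary \<Omega> u"
    and "bounded (u ` \<Omega>)"
    and "\<And>x. x \<in> \<Omega> \<Longrightarrow> laplacian u x + f (u x) = 0"
    and "\<And>x. x \<in> \<Omega> \<Longrightarrow> u x > 0"
    and "\<And>x. x \<in> frontier \<Omega> \<Longrightarrow> u x = 0"
    and "\<And>x. x \<in> frontier \<Omega> \<Longrightarrow> has_normal_derivative \<Omega> u x (- \<kappa>)"
  shows "(\<forall>x\<in>\<Omega>. P_function F u x \<le> max 0 (\<kappa>\<^sup>2 + 2 * F 0)) \<and>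
    ((\<exists>x0\<in>\<Omega>. P_function F u x0 = max 0 (\<kappa>\<^sup>2 + 2 * F 0)) \<longrightarrow>
       P_function F u constant_on \<Omega> \<and> one_dimensional_on \<Omega> u \<and> half_space \<Omega>)"
proof -
  have dom: "open \<Omega>" "connected \<Omega>" "frontier \<Omega> \<noteq> {}"
    using assms(2) by (auto simp: regular_domain_def)
  interpret semilinear_equation \<Omega> F f u
    using assms dom by unfold_locales auto
  obtain G where u: "continuous_on (closure \<Omega>) u" and G: "continuous_on (closure \<Omega>) G"
      "\<And>x. x \<in> \<Omega> \<Longrightarrow> G x = grad u x"
    using assms(7) by (auto simp: C1_up_to_boundary_def)
  obtain M where M: "\<And>x. x \<in> \<Omega> \<Longrightarrow> u x \<le> M"
    using assms(8) by (auto simp: bounded_iff abs_le_iff)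
  have "(norm (G x))\<^sup>2 \<le> \<kappa>\<^sup>2" if "x \<in> frontier \<Omega>" for x
    using boundary_gradient_norm[OF dom(1) that u u_differentiable G assms(10) assms(11)[OF that] assms(12)[OF that]]
    by simp
  hence le: "P_function F u x \<le> max 0 (\<kappa>\<^sup>2 + 2 * F 0)" if "x \<in> \<Omega>" for x
    using P_estimate[OF G u assms(10) M assms(11) _ that] by blast
  obtain p0 where p0: "p0 \<in> frontier \<Omega>" using dom(3) by blast
  obtain v where v: "\<And>t. 0 < t \<Longrightarrow> t \<le> 1 \<Longrightarrow> p0 + t *\<^sub>R v \<in> \<Omega>"
    using regular_domain_inward[OF assms(2) p0] by blast
  show ?thesis
    using le rigidity[OF dom(2) p0 u assms(10) M assms(11) v le] by auto
qed

end
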